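(* Let $X$ be a Banach space over $\mathbb{K}$ whose norm is micro-transitive and whose second numerical index satisfies $n'(X)>0$. Then $X$ has the Bishop–Phelps–Bollobás point property for numerical radius (BPBpp-nu).
   Context: Let $X$ be a Banach space over $\mathbb{K}\in\{\mathbb{R},\mathbb{C}\}$, with unit sphere $S_X$, dual $X^*$, and let $\mathcal{L}(X)$ denote the space of bounded linear operators on $X$ with the operator norm $\|T\|=\sup_{x\in S_X}\|Tx\|$. The set of states is $\Pi(X)=\{(x,x^* )\in S_X\times S_{X^*}: x^*(x)=1\}$. The numerical radius of $T\in\mathcal{L}(X)$ is $v(T)=\sup\{|x^*(Tx)|:(x,x^* )\in\Pi(X)\}$. Let $\mathcal{Z}(X)=\{T\in\mathcal{L}(X): v(T)=0\}$ and $\|T+\mathcal{Z}(X)\|=\inf\{\|T-G\|: G\in\mathcal{Z}(X)\}$. The second numerical index is $n'(X)=\inf\{v(T)/\|T+\mathcal{Z}(X)\| : T\in\mathcal{L}(X)\setminus\mathcal{Z}(X)\}$. The norm of $X$ is micro-transitive if, letting $G$ be the group of surjective linear isometries of $X$ (with the topology induced by the operator norm), for every $x\in S_X$ and every neighborhood $U$ of the identity in $G$, the set $\{g(x): g\in U\}$ is a neighborhood of $x$ in $S_X$. $X$ has the BPBpp-nu if for every $\varepsilon>0$ there is $\eta(\varepsilon)>0$ such that whenever $T\in\mathcal{L}(X)$ with $v(T)=1$ and $(x,x^* )\in\Pi(X)$ satisfy $|x^*(Tx)|>1-\eta(\varepsilon)$, there exists $S\in\mathcal{L}(X)$ with $v(S)=1$,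 $|x^*(Sx)|=1$ and $\|S-T\|<\varepsilon$. *)

theory Defs
  imports "HOL-Analysis.Analysis"
begin

text \<open>A Banach space over K (K = real or complex) is modelled as a real Banach space
 type 'a together with a scalar multiplication sc by the scalar field 'k that
 extends the real scalar multiplication and is compatible with the norm.
 For K = real we take sc = scaleR.\<close>

definition K_scaling :: "('k::real_normed_field \<Rightarrow> 'a::real_normed_vector \<Rightarrow> 'a) \<Rightarrow> bool" where
  "K_scaling sc \<longleftrightarrow>
     (\<forall>a b x. sc (a * b) x = sc a (sc b x)) \<and>
     (\<forall>a b x. sc (a + b) x = sc a x + sc b x) \<and>
     (\<forall>a x y. sc a (x + y) = sc a x + sc a y) \<and>
     (\<forall>r x. sc (of_real r) x = r *\<^sub>R x) \<and>
     (\<forall>a x. norm (sc a x) = norm a * norm x)"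

definition Klinear :: "('k::real_normed_field \<Rightarrow> 'a::real_normed_vector \<Rightarrow> 'a) \<Rightarrow> ('a \<Rightarrow> 'a) \<Rightarrow> bool" where
  "Klinear sc T \<longleftrightarrow> bounded_linear T \<and> (\<forall>c x. T (sc c x) = sc c (T x))"

definition Kfunctional :: "('k::real_normed_field \<Rightarrow> 'a::real_normed_vector \<Rightarrow> 'a) \<Rightarrow> ('a \<Rightarrow> 'k) \<Rightarrow> bool" where
  "Kfunctional sc f \<longleftrightarrow> bounded_linear f \<and> (\<forall>c x. f (sc c x) = c * f x)"

definition states :: "('k::real_normed_field \<Rightarrow> 'a::real_normed_vector \<Rightarrow> 'a) \<Rightarrow> ('a \<times> ('a \<Rightarrow> 'k)) set" where
  "states sc = {(x, f). norm x = 1 \<and> Kfunctional sc f \<and> onorm f = 1 \<and> f x = 1}"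

definition nradius :: "('k::real_normed_field \<Rightarrow> 'a::real_normed_vector \<Rightarrow> 'a) \<Rightarrow> ('a \<Rightarrow> 'a) \<Rightarrow> real" where
  "nradius sc T = (if states sc = {} then 0
                   else Sup ((\<lambda>(x, f). norm (f (T x))) ` states sc))"

definition Zset :: "('k::real_normed_field \<Rightarrow> 'a::real_normed_vector \<Rightarrow> 'a) \<Rightarrow> ('a \<Rightarrow> 'a) set" where
  "Zset sc = {T. Klinear sc T \<and> nradius sc T = 0}"

definition qnorm :: "('k::real_normed_field \<Rightarrow> 'a::real_normed_vector \<Rightarrow> 'a) \<Rightarrow> ('a \<Rightarrow> 'a) \<Rightarrow> real" where
  "qnorm sc T = Inf ((\<lambda>G. onorm (\<lambda>x. T x - G x)) ` Zset sc)"

text \<open>Second numerical index n'(X), as an extended real (infimum over the empty set is +infinity).\<close>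
definition second_nindex :: "('k::real_normed_field \<Rightarrow> 'a::real_normed_vector \<Rightarrow> 'a) \<Rightarrow> ereal" where
  "second_nindex sc =
     (INF T \<in> {T. Klinear sc T} - Zset sc. ereal (nradius sc T / qnorm sc T))"

definition isometry_group :: "('k::real_normed_field \<Rightarrow> 'a::real_normed_vector \<Rightarrow> 'a) \<Rightarrow> ('a \<Rightarrow> 'a) set" where
  "isometry_group sc = {g. Klinear sc g \<and> surj g \<and> (\<forall>x. norm (g x) = norm x)}"

text \<open>Micro-transitivity, with the operator-norm neighbourhoods of the identity
  written via their basic balls {g. ||g - Id|| < delta}.\<close>
definition micro_transitive :: "('k::real_normed_field \<Rightarrow> 'a::real_normed_vector \<Rightarrow> 'a) \<Rightarrow> bool" where
  "micro_transitive sc \<longleftrightarrow>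
     (\<forall>x. norm x = 1 \<longrightarrow> (\<forall>\<delta>>0. \<exists>\<epsilon>>0. \<forall>y. norm y = 1 \<and> norm (y - x) < \<epsilon> \<longrightarrow>
        (\<exists>g\<in>isometry_group sc. onorm (\<lambda>z. g z - z) < \<delta> \<and> g x = y)))"

definition BPBpp_nu :: "('k::real_normed_field \<Rightarrow> 'a::real_normed_vector \<Rightarrow> 'a) \<Rightarrow> bool" where
  "BPBpp_nu sc \<longleftrightarrow>
     (\<forall>\<epsilon>>0. \<exists>\<eta>>0. \<forall>T x f.
        Klinear sc T \<and> nradius sc T = 1 \<and> (x, f) \<in> states sc \<and> norm (f (T x)) > 1 - \<eta> \<longrightarrow>
        (\<exists>S. Klinear sc S \<and> nradius sc S = 1 \<and> norm (f (S x)) = 1 \<and>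
             onorm (\<lambda>y. S y - T y) < \<epsilon>))"

end

theory Submission
  imports Defs
begin

text \<open>
  If \<^term>\<open>x\<close> is moved to a nearby point by an isometry \<^term>\<open>g\<close> close to the identity, a functional
  supporting \<^term>\<open>x\<close> is moved to one supporting the image, and the two are close; hence a
  micro-transitive norm is uniformly smooth, and its dual is uniformly convex. The norm itself
  is also uniformly convex: otherwise all thin slices of the ball have, by transitivity, a common
  limit diameter \<^term>\<open>d > 0\<close> that is realised from every nearly extreme point, which yields
  arbitrarily long sequences whose terms have distance almost \<^term>\<open>d\<close> from the convex hull of their
  predecessors. Convexity arguments in the dual exclude such sequences.

  Now let \<^term>\<open>T\<close> almost attain its numerical radius at a state \<^term>\<open>(x, f)\<close>. After adding a
  small rotated multiple of the rank-one operator given by \<^term>\<open>f\<close> and \<^term>\<open>x\<close>, almost maximal states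
  lie, up to a scalar of modulus one, close to \<^term>\<open>x\<close> by uniform convexity; conjugation by an isometry
  close to the identity moves such a state back to \<^term>\<open>(x, f)\<close>. Iterating gives a limit operator
  that attains its numerical radius at \<^term>\<open>(x, f)\<close>. The steps depend on a bound for the norm of
  \<^term>\<open>T\<close>, and the hypothesis on the second numerical index provides it modulo operators of
  numerical radius zero.
\<close>

section \<open>Uniform smoothness\<close>

text \<open>The real dual unit ball: evaluating at \<open>- z\<close> turns the one-sided bound into
  \<open>\<bar>\<phi> z\<bar> \<le> norm z\<close>. Complex functionals enter through their real
  parts.\<close>

definition dual_ball :: "('a::real_normed_vector \<Rightarrow> real) \<Rightarrow> bool" where
  "dual_ball \<phi> \<longleftrightarrow> linear \<phi> \<and> (\<forall>z. \<phi> z \<le> norm z)"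

lemma dual_ballD:
  assumes "dual_ball \<phi>"
  shows "linear \<phi>" "\<phi> z \<le> norm z" "\<phi> (x + y) = \<phi> x + \<phi> y" "\<phi> (x - y) = \<phi> x - \<phi> y"
    "\<phi> (r *\<^sub>R x) = r * \<phi> x" "\<phi> (- x) = - \<phi> x" "\<phi> 0 = 0"
  using assms unfolding dual_ball_def
  by (auto simp: linear_add linear_diff linear_neg linear_0 linear_scale)

lemma dual_ball_minus:
  assumes "dual_ball \<phi>"
  shows "dual_ball (\<lambda>z. - \<phi> z)"
proof -
  have "- \<phi> z \<le> norm z" for z
    using dual_ballD(2)[OF assms, of "- z"] dual_ballD(6)[OF assms] by simp
  then show ?thesis
    using dual_ballD(1)[OF assms] by (simp add: dual_ball_def linear_compose_neg)
qed

text \<open>Normalising moves \<open>x + h\<close> by \<open>\<bar>1 - norm (x + h)\<bar>\<close>,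
  which is at most \<open>norm h\<close>; returning to \<open>x\<close> costs \<open>norm h\<close>
  once more.\<close>

lemma norm_sgn_diff:
  fixes x h :: "'a::real_normed_vector"
  assumes "norm x = 1" "x + h \<noteq> 0"
  shows "norm (sgn (x + h) - x) \<le> 2 * norm h"
proof -
  have e: "sgn (x + h) - (x + h) = (1 / norm (x + h) - 1) *\<^sub>R (x + h)"
    by (simp add: sgn_div_norm algebra_simps inverse_eq_divide)
  have "norm (sgn (x + h) - (x + h)) = \<bar>1 / norm (x + h) - 1\<bar> * norm (x + h)"
    by (simp only: e norm_scaleR)
  also have "\<dots> = \<bar>1 - norm (x + h)\<bar>"
  proof -
    have "\<bar>1 / norm (x + h) - 1\<bar> * norm (x + h) = \<bar>(1 / norm (x + h) - 1) * norm (x + h)\<bar>"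
      by (simp add: abs_mult)
    then show ?thesis
      using assms by (simp add: field_simps)
  qed
  also have "\<dots> \<le> norm h"
    using norm_triangle_ineq3[of "x + h" x] assms by simp
  finally have "norm (sgn (x + h) - (x + h)) \<le> norm h" .
  then show ?thesis
    using norm_triangle_ineq[of "sgn (x + h) - (x + h)" h] by simp
qed

lemma norm_sgn_minus_self:
  fixes x :: "'a::real_normed_vector"
  assumes "norm x \<le> 1" "x \<noteq> 0"
  shows "norm (sgn x - x) = 1 - norm x"
proof -
  have e: "sgn x - x = (1 / norm x - 1) *\<^sub>R x"
    by (simp add: sgn_div_norm algebra_simps inverse_eq_divide)
  have "1 / norm x - 1 \<ge> 0"
    using assms by simp
  then have "norm (sgn x - x) = (1 / norm x - 1) * norm x"
    by (simp only: e norm_scaleR abs_of_nonneg)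
  also have "\<dots> = 1 - norm x"
    using assms by (simp add: algebra_simps)
  finally show ?thesis .
qed

section \<open>Micro-transitive groups of linear isometries\<close>

locale micro_transitive_group =
  fixes G :: "('a::real_normed_vector \<Rightarrow> 'a) set"
  assumes lin: "g \<in> G \<Longrightarrow> linear g"
    and isom: "g \<in> G \<Longrightarrow> norm (g x) = norm x"
    and inverse: "g \<in> G \<Longrightarrow> \<exists>h\<in>G. \<forall>x. g (h x) = x \<and> h (g x) = x"
    and comp: "g \<in> G \<Longrightarrow> h \<in> G \<Longrightarrow> g \<circ> h \<in> G"
    and neg: "uminus \<in> G"
    and micro: "norm x = 1 \<Longrightarrow> \<delta> > 0 \<Longrightarrow> \<exists>\<epsilon>>0. \<forall>y. norm y = 1 \<and> norm (y - x) < \<epsilon> \<longrightarrow>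
        (\<exists>g\<in>G. (\<forall>z. norm (g z - z) \<le> \<delta> * norm z) \<and> g x = y)"
begin

text \<open>Micro-transitivity makes orbits relatively open, so a connected subset of the sphere
  lies in one orbit. The normalised segment from \<open>x\<close> to \<open>y\<close> is such a set
  unless \<open>y = - x\<close>, and that case is settled by \<open>uminus\<close>.\<close>

lemma transitive:
  assumes "norm x = 1" "norm y = 1"
  shows "\<exists>g\<in>G. g x = y"
proof (cases "y = - x")
  case True
  then show ?thesis using neg by (intro bexI[of _ uminus]) auto
next
  case False
  define R where "R = (\<lambda>x y. \<exists>g\<in>G. g x = y)"
  define C where "C = sgn ` closed_segment x y"
  have z: "0 \<notin> closed_segment x y"
  proof
    assume "0 \<in> closed_segment x y"
    then obtain u where u: "0 \<le> u" "u \<le> 1" "(1 - u) *\<^sub>R x + u *\<^sub>R y = 0"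
      unfolding closed_segment_def by force
    then have *: "(1 - u) *\<^sub>R x = - (u *\<^sub>R y)"
      by (simp add: eq_neg_iff_add_eq_0)
    then have "norm ((1 - u) *\<^sub>R x) = norm (u *\<^sub>R y)"
      by simp
    then have uu: "1 - u = u"
      using u assms by simp
    then have "u \<noteq> 0"
      by auto
    moreover have "u *\<^sub>R y = u *\<^sub>R (- x)"
      using * unfolding uu by (metis minus_minus scaleR_minus_right)
    ultimately have "y = - x"
      by (simp only: scaleR_cancel_left) simp
    then show False using False by simp
  qed
  have "connected C"
    unfolding C_def using z
    by (intro connected_continuous_image connected_segment continuous_on_sgn)
       (auto intro: continuous_intros)
  moreover have "x \<in> C" "y \<in> C"
    using image_eqI[of x sgn x] image_eqI[of y sgn y] assms unfolding C_def
    by (simp_all add: sgn_div_norm)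
  moreover have sphere: "norm c = 1" if "c \<in> C" for c
    using that z unfolding C_def by (auto simp: norm_sgn)
  moreover have "\<exists>T. openin (top_of_set C) T \<and> a \<in> T \<and> (\<forall>x\<in>T. R a x)" if a: "a \<in> C" for a
  proof -
    \<comment> \<open>The displacement bound 1 is arbitrary: only the orbit matters here.\<close>
    obtain e where "e > 0" and e: "\<And>y. norm y = 1 \<Longrightarrow> norm (y - a) < e \<Longrightarrow> R a y"
      using micro[OF sphere[OF a], of 1] unfolding R_def by auto
    show ?thesis
    proof (intro exI[of _ "C \<inter> ball a e"] conjI)
      show "openin (top_of_set C) (C \<inter> ball a e)"
        by (simp add: openin_open_Int)
      show "a \<in> C \<inter> ball a e"
        using a \<open>e > 0\<close> by simp
      show "\<forall>x\<in>C \<inter> ball a e. R a x"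
        using e sphere by (auto simp: dist_norm norm_minus_commute)
    qed
  qed
  moreover have "R b a" if "R a b" for a b
    using that inverse unfolding R_def by metis
  moreover have "R a c" if "R a b" "R b c" for a b c
    using that comp unfolding R_def by (metis comp_apply)
  ultimately have "R x y"
    by (intro connected_equivalence_relation[of C x y R]) blast+
  then show ?thesis unfolding R_def .
qed

text \<open>The radius at a single point \<open>x0\<close> works everywhere: conjugating by an
  isometry that sends \<open>x0\<close> to \<open>x\<close> preserves displacement bounds.\<close>

lemma uniformly_micro_transitive:
  assumes "\<delta> > 0"
  shows "\<exists>\<epsilon>>0. \<forall>x y. norm x = 1 \<and> norm y = 1 \<and> norm (y - x) < \<epsilon> \<longrightarrow>
    (\<exists>g\<in>G. (\<forall>z. norm (g z - z) \<le> \<delta> * norm z) \<and> g x = y)"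
proof (cases "\<exists>x::'a. norm x = 1")
  case False
  then show ?thesis by (intro exI[of _ 1]) auto
next
  case True
  then obtain x0 :: 'a where x0: "norm x0 = 1" by blast
  from micro[OF this assms] obtain \<epsilon> where "\<epsilon> > 0" and \<epsilon>:
    "\<And>y. norm y = 1 \<Longrightarrow> norm (y - x0) < \<epsilon> \<Longrightarrow>
        (\<exists>g\<in>G. (\<forall>z. norm (g z - z) \<le> \<delta> * norm z) \<and> g x0 = y)"
    by blast
  have "\<exists>g\<in>G. (\<forall>z. norm (g z - z) \<le> \<delta> * norm z) \<and> g x = y"
    if xy: "norm x = 1" "norm y = 1" "norm (y - x) < \<epsilon>" for x y
  proof -
    obtain h where h: "h \<in> G" "h x0 = x"
      using transitive[OF x0 xy(1)] by blast
    obtain k where k: "k \<in> G" "\<And>x. h (k x) = x" "\<And>x. k (h x) = x"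
      using inverse[OF h(1)] by blast
    have "norm (k y - x0) = norm (k (y - x))"
      using k(3)[of x0] h(2) lin[OF k(1)] by (simp add: linear_diff)
    then obtain g where g: "g \<in> G" "\<And>z. norm (g z - z) \<le> \<delta> * norm z" "g x0 = k y"
      using \<epsilon>[of "k y"] isom[OF k(1)] xy by auto
    have "norm ((h \<circ> g \<circ> k) z - z) \<le> \<delta> * norm z" for z
    proof -
      have "norm ((h \<circ> g \<circ> k) z - z) = norm (h (g (k z) - k z))"
        using lin[OF h(1)] k(2) by (simp add: linear_diff)
      then show ?thesis
        using g(2)[of "k z"] isom[OF h(1)] isom[OF k(1)] by simp
    qed
    moreover have "(h \<circ> g \<circ> k) x = y"
      using k(3)[of x0] h(2) g(3) k(2) by simp
    ultimately show ?thesis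
      using comp[OF comp[OF h(1) g(1)] k(1)] by blast
  qed
  then show ?thesis using \<open>\<epsilon> > 0\<close> by blast
qed

lemma inverse_displacement:
  assumes "g \<in> G" "\<And>z. norm (g z - z) \<le> \<delta> * norm z" "\<And>x. g (h x) = x" "h \<in> G"
  shows "norm (h z - z) \<le> \<delta> * norm z"
  using assms(2)[of "h z"] assms(3) isom[OF assms(4)] by (simp add: norm_minus_commute)

lemma dual_ball_comp:
  assumes "dual_ball \<phi>" "g \<in> G"
  shows "dual_ball (\<phi> \<circ> g)"
  using assms dual_ballD[OF assms(1)] isom[OF assms(2)] lin[OF assms(2)]
  unfolding dual_ball_def by (metis comp_apply linear_compose)

text \<open>Near \<^term>\<open>x\<close> the isometries are close to the identity, so they carry \<^term>\<open>\<phi>\<close> to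
  nearby functionals that support the nearby points.\<close>

lemma uniformly_smooth:
  assumes "\<delta> > 0"
  shows "\<exists>\<tau>>0. \<forall>(x::'a) \<phi> h. norm x = 1 \<and> dual_ball \<phi> \<and> \<phi> x = 1 \<and> norm h \<le> \<tau> \<longrightarrow>
    norm (x + h) \<le> 1 + \<phi> h + \<delta> * norm h"
proof -
  obtain \<epsilon> where "\<epsilon> > 0" and \<epsilon>: "\<And>x y. norm x = 1 \<Longrightarrow> norm y = 1 \<Longrightarrow> norm (y - x) < \<epsilon> \<Longrightarrow>
    (\<exists>g\<in>G. (\<forall>z. norm (g z - z) \<le> \<delta> * norm z) \<and> g x = y)"
    using uniformly_micro_transitive[OF assms] by blast
  \<comment> \<open>The bound 1/2 keeps \<open>x + h\<close> away from 0; \<epsilon>/4 keeps its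
    normalisation within \<epsilon> of \<open>x\<close>, as \<open>norm_sgn_diff\<close> doubles the
    distance.\<close>
  define \<tau> where "\<tau> = min (1/2) (\<epsilon>/4)"
  have "norm (x + h) \<le> 1 + \<phi> h + \<delta> * norm h"
    if x: "norm x = 1" and \<phi>: "dual_ball \<phi>" "\<phi> x = 1" and h: "norm h \<le> \<tau>" for x :: 'a and \<phi> h
  proof -
    have "x + h \<noteq> 0"
    proof
      assume "x + h = 0"
      then have "norm h = 1"
        using x by (metis add_eq_0_iff norm_minus_cancel)
      then show False using h by (simp add: \<tau>_def)
    qed
    then have y: "norm (sgn (x + h)) = 1" "norm (sgn (x + h) - x) < \<epsilon>"
      using norm_sgn_diff[OF x \<open>x + h \<noteq> 0\<close>] h \<open>\<epsilon> > 0\<close> \<open>x + h \<noteq> 0\<close> by (auto simp: norm_sgn \<tau>_def)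
    obtain g where g: "g \<in> G" "\<And>z. norm (g z - z) \<le> \<delta> * norm z" "g x = sgn (x + h)"
      using \<epsilon>[OF x y] by blast
    obtain k where k: "k \<in> G" "\<And>x. g (k x) = x" "\<And>x. k (g x) = x"
      using inverse[OF g(1)] by blast
    have s: "x + h = norm (x + h) *\<^sub>R g x"
      using g(3) \<open>x + h \<noteq> 0\<close> by (simp add: sgn_div_norm)
    have "k (x + h) = norm (x + h) *\<^sub>R x"
      using lin[OF k(1)] by (subst s) (simp add: linear_scale k(3))
    \<comment> \<open>\<open>k\<close> takes \<open>x + h\<close> to the ray through
      \<open>x\<close>, where \<phi> equals the norm. Then \<open>\<phi> (k x)\<close> is at most 1,
      and replacing \<open>k h\<close> by \<open>h\<close> costs the displacement of
      \<open>k\<close>.\<close>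
    then have "norm (x + h) = \<phi> (k (x + h))"
      using \<phi> by (simp add: dual_ballD)
    also have "\<dots> = \<phi> (k x) + \<phi> h + \<phi> (k h - h)"
      using lin[OF k(1)] by (simp add: dual_ballD[OF \<phi>(1)] linear_add)
    also have "\<dots> \<le> 1 + \<phi> h + \<delta> * norm h"
      using dual_ballD(2)[OF \<phi>(1), of "k x"] isom[OF k(1)] x dual_ballD(2)[OF \<phi>(1), of "k h - h"]
        inverse_displacement[OF g(1,2) k(2) k(1), of h] by (simp add: add_mono)
    finally show ?thesis .
  qed
  moreover have "\<tau> > 0" using \<open>\<epsilon> > 0\<close> by (simp add: \<tau>_def)
  ultimately show ?thesis by blast
qed

end

section \<open>Supporting functionals and uniform convexity of the dual\<close>

locale supported_micro_transitive_group = micro_transitive_group G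
  for G :: "('a::real_normed_vector \<Rightarrow> 'a) set" +
  fixes x\<^sub>0 :: 'a and \<phi>\<^sub>0 :: "'a \<Rightarrow> real"
  assumes base: "norm x\<^sub>0 = 1" "dual_ball \<phi>\<^sub>0" "\<phi>\<^sub>0 x\<^sub>0 = 1"
begin

text \<open>No Hahn-Banach argument is needed: transitivity transports the one given supporting
  functional to every point of the sphere.\<close>

lemma support_exists:
  fixes x :: 'a
  shows "\<exists>\<phi>. dual_ball \<phi> \<and> \<phi> x = norm x"
proof -
  have unit: "\<exists>\<phi>. dual_ball \<phi> \<and> \<phi> x = 1" if x: "norm x = 1" for x :: 'a
  proof -
    obtain g where g: "g \<in> G" "g x = x\<^sub>0"
      using transitive[OF x base(1)] by blast
    show ?thesis
      using dual_ball_comp[OF base(2) g(1)] g(2) base(3) by (intro exI[of _ "\<phi>\<^sub>0 \<circ> g"]) simp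
  qed
  show ?thesis
  proof (cases "x = 0")
    case True
    then show ?thesis using base(2) dual_ballD(7) by (intro exI[of _ \<phi>\<^sub>0]) auto
  next
    case False
    then obtain \<phi> where "dual_ball \<phi>" "\<phi> (sgn x) = 1"
      using unit[of "sgn x"] by (auto simp: norm_sgn)
    then show ?thesis
      using False by (intro exI[of _ \<phi>]) (auto simp: sgn_div_norm dual_ballD field_simps)
  qed
qed

text \<open>Dual to uniform smoothness: if \<psi> almost norms \<open>x\<close>, then
  \<open>\<psi> (x + k) \<le> norm (x + k)\<close> and the smoothness estimate force \<psi> to be
  close to the support functional at \<open>x\<close>. Two such \<psi> are then close to each
  other.\<close>

lemma dual_uniformly_convex:
  assumes "\<epsilon> > 0"
  shows "\<exists>\<delta>>0. \<forall>\<psi> \<psi>' (x::'a). dual_ball \<psi> \<and> dual_ball \<psi>' \<and> norm x \<le> 1 \<and> \<psi> x \<ge> 1 - \<delta> \<and> \<psi>' x \<ge> 1 - \<delta> \<longrightarrow>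
    (\<forall>h. \<psi> h - \<psi>' h \<le> \<epsilon> * norm h)"
proof -
  obtain \<tau> where "\<tau> > 0" and \<tau>: "\<And>(x::'a) \<phi> h. norm x = 1 \<Longrightarrow> dual_ball \<phi> \<Longrightarrow> \<phi> x = 1 \<Longrightarrow> norm h \<le> \<tau> \<Longrightarrow>
    norm (x + h) \<le> 1 + \<phi> h + \<epsilon> / 4 * norm h"
    using uniformly_smooth[of "\<epsilon> / 4"] assms by auto
  \<comment> \<open>The bound 1/2 forces \<open>x \<noteq> 0\<close>; the other makes the defect
    \<delta> at most the smoothness error at length \<tau>.\<close>
  define \<delta> where "\<delta> = min (1/2) (\<epsilon> * \<tau> / 4)"
  have half: "\<psi> h - \<phi> h \<le> \<epsilon> / 2 * norm h"
    if x: "norm x = 1" and \<phi>: "dual_ball \<phi>" "\<phi> x = 1" and \<psi>: "dual_ball \<psi>" "\<psi> x \<ge> 1 - \<delta>" for x :: 'a and \<phi> \<psi> h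
  proof (cases "h = 0")
    case True
    then show ?thesis using \<phi> \<psi> by (simp add: dual_ballD)
  next
    case False
    define k where "k = (\<tau> / norm h) *\<^sub>R h"
    have k: "norm k = \<tau>"
      using False \<open>\<tau> > 0\<close> by (simp add: k_def)
    have "\<psi> x + \<psi> k \<le> norm (x + k)"
      using dual_ballD(2,3)[OF \<psi>(1)] by metis
    also have "\<dots> \<le> 1 + \<phi> k + \<epsilon> / 4 * \<tau>"
      using \<tau>[OF x \<phi>, of k] k by simp
    finally have "\<psi> k - \<phi> k \<le> \<epsilon> / 4 * \<tau> + \<delta>"
      using \<psi>(2) by simp
    also have "\<dots> \<le> \<epsilon> / 2 * \<tau>"
      by (simp add: \<delta>_def)
    finally have "\<tau> / norm h * (\<psi> h - \<phi> h) \<le> \<epsilon> / 2 * \<tau>"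
      by (simp add: k_def dual_ballD[OF \<psi>(1)] dual_ballD[OF \<phi>(1)] algebra_simps)
    then have "\<tau> * (\<psi> h - \<phi> h) \<le> \<tau> * (\<epsilon> / 2 * norm h)"
      using False by (simp add: field_simps)
    then show ?thesis
      using \<open>\<tau> > 0\<close> by (simp only: mult_le_cancel_left_pos)
  qed
  have "\<psi> h - \<psi>' h \<le> \<epsilon> * norm h"
    if \<psi>: "dual_ball \<psi>" "dual_ball \<psi>'" and x: "norm x \<le> 1" "\<psi> x \<ge> 1 - \<delta>" "\<psi>' x \<ge> 1 - \<delta>" for \<psi> \<psi>' and x h :: 'a
  proof -
    have "\<psi> x > 0" using x by (simp add: \<delta>_def)
    then have x0: "x \<noteq> 0" using dual_ballD(7)[OF \<psi>(1)] by auto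
    obtain \<phi> where \<phi>: "dual_ball \<phi>" "\<phi> x = norm x"
      using support_exists by blast
    have sgn: "norm (sgn x) = 1" "\<phi> (sgn x) = 1"
      using x0 \<phi> by (auto simp: norm_sgn sgn_div_norm dual_ballD)
    \<comment> \<open>As \<open>norm x \<le> 1\<close> and the value is positive, normalising can
      only increase it.\<close>
    have ge: "\<xi> (sgn x) \<ge> 1 - \<delta>" if "dual_ball \<xi>" "\<xi> x \<ge> 1 - \<delta>" for \<xi>
    proof -
      have "\<xi> x > 0" using that by (simp add: \<delta>_def)
      then have "\<xi> x \<le> \<xi> x / norm x"
        using x(1) x0 by (simp add: field_simps mult_left_le)
      also have "\<dots> = \<xi> (sgn x)"
        using that by (simp add: sgn_div_norm dual_ballD divide_inverse_commute)
      finally show ?thesis using that by simp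
    qed
    have "\<psi>' (- h) - \<phi> (- h) \<le> \<epsilon> / 2 * norm h"
      using half[OF sgn(1) \<phi>(1) sgn(2) \<psi>(2) ge[OF \<psi>(2) x(3)], of "- h"] by simp
    then show ?thesis
      using half[OF sgn(1) \<phi>(1) sgn(2) \<psi>(1) ge[OF \<psi>(1) x(2)], of h]
      by (simp add: dual_ballD[OF \<phi>(1)] dual_ballD[OF \<psi>(2)])
  qed
  moreover have "\<delta> > 0" using assms \<open>\<tau> > 0\<close> by (simp add: \<delta>_def)
  ultimately show ?thesis by blast
qed

text \<open>Functionals that norm \<open>x\<close> exactly satisfy the premise of dual uniform
  convexity for every \<epsilon>.\<close>

lemma support_unique:
  fixes x :: 'a
  assumes "norm x = 1" "dual_ball \<phi>" "\<phi> x = 1" "dual_ball \<psi>" "\<psi> x = 1"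
  shows "\<phi> = \<psi>"
proof
  fix z
  have le: "\<alpha> z - \<beta> z \<le> 0" if "dual_ball \<alpha>" "\<alpha> x = 1" "dual_ball \<beta>" "\<beta> x = 1" for \<alpha> \<beta>
  proof (rule field_le_epsilon)
    fix e :: real assume "e > 0"
    define \<epsilon> where "\<epsilon> = e / (norm z + 1)"
    have "\<epsilon> > 0" using \<open>e > 0\<close> by (simp add: \<epsilon>_def add_nonneg_pos)
    obtain \<delta> where "\<delta> > 0" and \<delta>: "\<And>\<psi> \<psi>' (x::'a) h. dual_ball \<psi> \<Longrightarrow> dual_ball \<psi>' \<Longrightarrow> norm x \<le> 1 \<Longrightarrow>
        \<psi> x \<ge> 1 - \<delta> \<Longrightarrow> \<psi>' x \<ge> 1 - \<delta> \<Longrightarrow> \<psi> h - \<psi>' h \<le> \<epsilon> * norm h"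
      using dual_uniformly_convex[OF \<open>\<epsilon> > 0\<close>] by blast
    have "\<alpha> z - \<beta> z \<le> \<epsilon> * norm z"
      using \<delta>[of \<alpha> \<beta> x z] that assms(1) \<open>\<delta> > 0\<close> by simp
    also have "\<dots> \<le> \<epsilon> * (norm z + 1)"
      using \<open>\<epsilon> > 0\<close> by simp
    also have "\<dots> = e"
      using add_nonneg_pos[OF norm_ge_zero[of z] zero_less_one] by (simp add: \<epsilon>_def)
    finally show "\<alpha> z - \<beta> z \<le> 0 + e" by simp
  qed
  from le[OF assms(2-5)] le[OF assms(4,5,2,3)] show "\<phi> z = \<psi> z" by simp
qed

end

section \<open>Uniform convexity\<close>

text \<open>The index \<^term>\<open>N\<close> of a family \<^term>\<open>f i N\<close> numbers finite sequences \<^term>\<open>\<lambda>i. f i N\<close> of growing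
  length. Iterated midpoints replace convex combinations: the same weights are used for
  all \<^term>\<open>N\<close>, so that a compactness argument over \<^term>\<open>N\<close> is possible.\<close>

inductive midpoints :: "(nat \<Rightarrow> nat \<Rightarrow> 'a \<Rightarrow> real) \<Rightarrow> nat \<Rightarrow> nat \<Rightarrow> (nat \<Rightarrow> 'a \<Rightarrow> real) \<Rightarrow> bool"
  for f a b where
  base: "a \<le> i \<Longrightarrow> i \<le> b \<Longrightarrow> midpoints f a b (f i)"
| step: "midpoints f a b \<psi> \<Longrightarrow> midpoints f a b \<psi>' \<Longrightarrow> midpoints f a b (\<lambda>N z. (\<psi> N z + \<psi>' N z) / 2)"

lemma midpoints_mono:
  assumes "midpoints f a b \<psi>" "a' \<le> a" "b \<le> b'"
  shows "midpoints f a' b' \<psi>"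
  using assms by (induction rule: midpoints.induct) (auto intro: midpoints.intros)

text \<open>A mean is never below both of its terms. This extracts a single functional from an
  average, and its index also shows \<open>a \<le> b\<close>.\<close>

lemma midpoints_lower:
  assumes "midpoints f a b \<psi>"
  shows "\<exists>i. a \<le> i \<and> i \<le> b \<and> f i N z \<le> \<psi> N z"
  using assms
proof (induction rule: midpoints.induct)
  case (step \<psi> \<psi>')
  show ?case
  proof (cases "\<psi> N z \<le> \<psi>' N z")
    case True
    then show ?thesis using step.IH(1) by force
  next
    case False
    then show ?thesis using step.IH(2) by force
  qed
qed auto

lemma midpoints_upper:
  assumes "midpoints f a b \<psi>"
  shows "\<exists>i. a \<le> i \<and> i \<le> b \<and> \<psi> N z \<le> f i N z"
  using assms
proof (induction rule: midpoints.induct)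
  case (step \<psi> \<psi>')
  show ?case
  proof (cases "\<psi> N z \<le> \<psi>' N z")
    case True
    then show ?thesis using step.IH(2) by force
  next
    case False
    then show ?thesis using step.IH(1) by force
  qed
qed auto

lemma midpoints_dual_ball:
  assumes "midpoints f a b \<psi>" "\<And>i. dual_ball (f i N)"
  shows "dual_ball (\<psi> N)"
  using assms(1)
proof (induction rule: midpoints.induct)
  case (step \<psi> \<psi>')
  have "linear (\<lambda>z. (1/2) *\<^sub>R (\<psi> N z + \<psi>' N z))"
    using step.IH by (intro linear_compose_scale_right linear_compose_add) (auto simp: dual_ball_def)
  moreover have "(\<psi> N z + \<psi>' N z) / 2 \<le> norm z" for z
    using dual_ballD(2)[OF step.IH(1), of z] dual_ballD(2)[OF step.IH(2), of z] by simp
  ultimately show ?case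
    by (simp add: dual_ball_def)
qed (use assms in auto)

context supported_micro_transitive_group
begin

text \<open>Elements of almost minimal norm in the convex hulls of two tails are close by uniform convexity
  of the dual. The minimal norms \<^term>\<open>r k\<close> are those in the limit of large \<^term>\<open>N\<close>.\<close>

lemma midpoints_close:
  fixes f :: "nat \<Rightarrow> nat \<Rightarrow> 'a \<Rightarrow> real"
  assumes f: "\<And>i N. dual_ball (f i N)" and "\<epsilon> > 0"
  shows "\<exists>b c \<psi> \<psi>' N. midpoints f 1 b \<psi> \<and> midpoints f (b + 2) c \<psi>' \<and> c \<le> N \<and>
    (\<forall>z. \<psi> N z - \<psi>' N z \<le> \<epsilon> * norm z)"
proof -
  obtain \<delta> where "\<delta> > 0" and \<delta>: "\<And>\<psi> \<psi>' (x::'a) h. dual_ball \<psi> \<Longrightarrow> dual_ball \<psi>' \<Longrightarrow> norm x \<le> 1 \<Longrightarrow>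
        \<psi> x \<ge> 1 - \<delta> \<Longrightarrow> \<psi>' x \<ge> 1 - \<delta> \<Longrightarrow> \<psi> h - \<psi>' h \<le> \<epsilon> / 2 * norm h"
    using dual_uniformly_convex[of "\<epsilon> / 2"] \<open>\<epsilon> > 0\<close> by (metis half_gt_zero)
  \<comment> \<open>\<open>S k\<close> collects the norm bounds that one fixed combination of the
    tail from \<open>k\<close> obeys for all large \<open>N\<close>. Tails shrink, so the infima
    \<open>r k\<close> increase; \<rho> is their limit.\<close>
  define S where "S k = {t. 0 \<le> t \<and> (\<exists>b \<psi>. midpoints f k b \<psi> \<and>
      (\<forall>\<^sub>F N in sequentially. \<forall>z. \<psi> N z \<le> t * norm z))}" for k
  define r where "r k = Inf (S k)" for k
  have S1: "1 \<in> S k" for k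
    unfolding S_def using f by (auto simp: dual_ball_def intro!: exI[of _ k] exI[of _ "f k"] midpoints.base)
  have bdd: "bdd_below (S k)" for k
    by (rule bdd_belowI[of _ 0]) (simp add: S_def)
  have r_le_1: "r k \<le> 1" for k
    unfolding r_def by (rule cInf_lower[OF S1 bdd])
  have r_ge_0: "0 \<le> r k" for k
    unfolding r_def
  proof (rule cInf_greatest)
    show "S k \<noteq> {}" using S1 by blast
  qed (simp add: S_def)
  have S_anti: "S k' \<subseteq> S k" if "k \<le> k'" for k k'
    unfolding S_def using that midpoints_mono[of f k' _ _ k] by blast
  have r_mono: "r k \<le> r k'" if "k \<le> k'" for k k'
    unfolding r_def using S1 by (intro cInf_superset_mono S_anti[OF that] bdd) auto
  define \<rho> where "\<rho> = (SUP k. r k)"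
  have bddr: "bdd_above (range r)"
    using r_le_1 by (intro bdd_aboveI[of _ 1]) auto
  have r_le: "r k \<le> \<rho>" for k
    unfolding \<rho>_def by (rule cSUP_upper[OF UNIV_I bddr])
  have \<rho>: "0 \<le> \<rho>" "\<rho> \<le> 1"
    using r_ge_0[of 0] r_le[of 0] r_le_1 by (auto simp: \<rho>_def intro: cSUP_least)
  \<comment> \<open>The bound 1 gives \<open>s \<le> 2\<close>; \<epsilon>/8 serves small \<rho> and
    the positivity of \<open>\<rho> - \<eta>\<close>; the last one gives
    \<open>4 * \<eta> \<le> s * \<delta>\<close> when \<rho> is at least \<epsilon>/4.\<close>
  define \<eta> where "\<eta> = min 1 (min (\<epsilon> / 8) (\<epsilon> * \<delta> / 16))"
  define s where "s = \<rho> + \<eta>"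
  have \<eta>: "\<eta> > 0" "\<eta> \<le> 1" "\<eta> \<le> \<epsilon> / 8" "\<eta> \<le> \<epsilon> * \<delta> / 16"
    using \<open>\<epsilon> > 0\<close> \<open>\<delta> > 0\<close> by (auto simp: \<eta>_def)
  have s: "s > 0" "s \<le> 2"
    using \<rho> \<eta> by (auto simp: s_def)
  obtain K' where "\<rho> - \<eta> < r K'"
    using less_cSUP_iff[OF _ bddr, of "\<rho> - \<eta>"] \<eta> by (auto simp: \<rho>_def)
  then have K: "\<rho> - \<eta> < r (max 1 K')"
    using r_mono[of K' "max 1 K'"] by simp
  \<comment> \<open>At least 1, so that the index 0 stays outside both combinations.\<close>
  define K where "K = max 1 K'"
  have small: "\<exists>b \<psi>. midpoints f k b \<psi> \<and> (\<forall>\<^sub>F N in sequentially. \<forall>z. \<psi> N z \<le> s * norm z)" for k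
  proof -
    have "r k < s"
      using r_le[of k] \<eta> by (simp add: s_def)
    then obtain t where "t \<in> S k" "t < s"
      unfolding r_def using cInf_lessD[of "S k" s] S1 by auto
    then obtain b \<psi> where b: "midpoints f k b \<psi>" "\<forall>\<^sub>F N in sequentially. \<forall>z. \<psi> N z \<le> t * norm z"
      by (auto simp: S_def)
    have "\<forall>\<^sub>F N in sequentially. \<forall>z. \<psi> N z \<le> s * norm z"
      using b(2) by eventually_elim
        (use \<open>t < s\<close> in \<open>meson less_imp_le mult_right_mono norm_ge_zero order_trans\<close>)
    then show ?thesis using b(1) by blast
  qed
  obtain b \<psi> where \<psi>: "midpoints f K b \<psi>" "\<forall>\<^sub>F N in sequentially. \<forall>z. \<psi> N z \<le> s * norm z"
    using small by blast
  \<comment> \<open>Starting at \<open>b + 2\<close> leaves the index \<open>b + 1\<close> free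
    between the two blocks.\<close>
  obtain c \<psi>' where \<psi>': "midpoints f (b + 2) c \<psi>'" "\<forall>\<^sub>F N in sequentially. \<forall>z. \<psi>' N z \<le> s * norm z"
    using small by blast
  have Kb: "K \<le> b" and bc: "b + 2 \<le> c"
    using midpoints_lower[OF \<psi>(1)] midpoints_lower[OF \<psi>'(1)] by force+
  have ev: "\<forall>\<^sub>F N in sequentially. c \<le> N \<and> (\<forall>z. \<psi> N z \<le> s * norm z) \<and> (\<forall>z. \<psi>' N z \<le> s * norm z)"
    using eventually_ge_at_top[of c] \<psi>(2) \<psi>'(2) by eventually_elim auto
  have "\<exists>N\<ge>c. \<forall>z. \<psi> N z - \<psi>' N z \<le> \<epsilon> * norm z"
  \<comment> \<open>For small \<rho> both functionals are small, and the triangle inequality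
    suffices.\<close>
  proof (cases "\<rho> < \<epsilon> / 4")
    case True
    obtain N where N: "c \<le> N" "\<And>z. \<psi> N z \<le> s * norm z" "\<And>z. \<psi>' N z \<le> s * norm z"
      using eventually_happens[OF ev] by auto
    have "\<psi> N z - \<psi>' N z \<le> \<epsilon> * norm z" for z
    proof -
      have "- \<psi>' N z \<le> s * norm z"
        using N(3)[of "- z"] dual_ballD(6)[OF midpoints_dual_ball[OF \<psi>'(1) f]] by simp
      then have "\<psi> N z - \<psi>' N z \<le> (2 * s) * norm z"
        using N(2)[of z] by simp
      also have "\<dots> \<le> \<epsilon> * norm z"
        using True \<eta> by (intro mult_right_mono) (auto simp: s_def)
      finally show ?thesis .
    qed
    then show ?thesis using N(1) by blast
  next
    case False
    \<comment> \<open>The mean again belongs to the tail from \<open>K\<close>, so its norm exceeds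
      \<open>\<rho> - \<eta>\<close> for infinitely many \<open>N\<close>. As both terms have norm
      at most \<open>s\<close>, both almost attain it at the same unit vector.\<close>
    define \<mu> where "\<mu> = (\<lambda>N z. (\<psi> N z + \<psi>' N z) / 2)"
    have "midpoints f K c \<mu>"
      unfolding \<mu>_def using \<psi>(1) \<psi>'(1) Kb bc
      by (intro midpoints.step) (auto elim!: midpoints_mono)
    moreover have "\<rho> - \<eta> \<notin> S K"
      using K cInf_lower[OF _ bdd, of "\<rho> - \<eta>" K] by (auto simp: r_def K_def)
    moreover have pos: "\<rho> - \<eta> > 0"
      using False \<eta>(3) \<open>\<epsilon> > 0\<close> by simp
    ultimately have "\<exists>\<^sub>F N in sequentially. \<exists>z. \<mu> N z > (\<rho> - \<eta>) * norm z"
      by (force simp: S_def frequently_def not_less)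
    from frequently_eventually_frequently[OF this ev]
    obtain N z where N: "\<mu> N z > (\<rho> - \<eta>) * norm z" "c \<le> N" "\<And>z. \<psi> N z \<le> s * norm z"
      "\<And>z. \<psi>' N z \<le> s * norm z"
      by (auto dest!: frequently_ex)
    have db: "dual_ball (\<psi> N)" "dual_ball (\<psi>' N)"
      using midpoints_dual_ball \<psi>(1) \<psi>'(1) f by blast+
    have "z \<noteq> 0"
      using N(1) dual_ballD(7)[OF db(1)] dual_ballD(7)[OF db(2)] by (auto simp: \<mu>_def)
    define u where "u = sgn z"
    have u: "norm u = 1"
      using \<open>z \<noteq> 0\<close> by (simp add: u_def norm_sgn)
    have "\<psi> N u = \<psi> N z / norm z" "\<psi>' N u = \<psi>' N z / norm z"
      by (simp_all add: u_def sgn_div_norm dual_ballD(5)[OF db(1)] dual_ballD(5)[OF db(2)]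
          divide_inverse_commute)
    then have "\<psi> N u + \<psi>' N u = 2 * (\<mu> N z / norm z)"
      by (simp add: \<mu>_def add_divide_distrib)
    moreover have "\<rho> - \<eta> < \<mu> N z / norm z"
      using N(1) \<open>z \<noteq> 0\<close> by (simp add: pos_less_divide_eq)
    ultimately have sum: "\<psi> N u + \<psi>' N u > 2 * (\<rho> - \<eta>)"
      by simp
    \<comment> \<open>Each value at \<open>u\<close> is at most \<open>s\<close>, so the other is at
      least \<open>2 * (\<rho> - \<eta>) - s\<close>, which equals
      \<open>s - 4 * \<eta>\<close>.\<close>
    have "1 - \<delta> \<le> 1 - 4 * \<eta> / s"
    proof -
      have "4 * \<eta> \<le> \<epsilon> / 4 * \<delta>"
        using \<eta>(4) by simp
      also have "\<dots> \<le> s * \<delta>"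
        using False \<eta>(1) \<open>\<delta> > 0\<close> by (intro mult_right_mono) (auto simp: s_def)
      finally show ?thesis using s(1) by (simp add: field_simps)
    qed
    also have "\<dots> = (2 * (\<rho> - \<eta>) - s) / s"
      using s(1) by (simp add: s_def field_simps)
    finally have *: "1 - \<delta> \<le> (2 * (\<rho> - \<eta>) - s) / s" .
    have scaled: "dual_ball (\<lambda>w. \<xi> w / s)" if "dual_ball \<xi>" "\<And>z. \<xi> z \<le> s * norm z" for \<xi> :: "'a \<Rightarrow> real"
    proof -
      have "linear (\<lambda>w. (1 / s) *\<^sub>R \<xi> w)"
        using that(1) by (intro linear_compose_scale_right) (simp add: dual_ball_def)
      then show ?thesis
        using that(2) s(1) by (simp add: dual_ball_def field_simps)
    qed
    have "\<psi> N h - \<psi>' N h \<le> \<epsilon> * norm h" for h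
    proof -
      have "\<psi> N u / s \<ge> 1 - \<delta>" "\<psi>' N u / s \<ge> 1 - \<delta>"
        using sum N(3)[of u] N(4)[of u] u s(1)
        by (auto intro!: order_trans[OF *] divide_right_mono)
      then have "\<psi> N h / s - \<psi>' N h / s \<le> \<epsilon> / 2 * norm h"
        using \<delta>[OF scaled[OF db(1) N(3)] scaled[OF db(2) N(4)], of u h] u by simp
      then have "\<psi> N h - \<psi>' N h \<le> s * (\<epsilon> / 2 * norm h)"
        using s(1) by (simp add: field_simps)
      also have "\<dots> \<le> 2 * (\<epsilon> / 2 * norm h)"
        using s \<open>\<epsilon> > 0\<close> by (intro mult_right_mono) auto
      finally show ?thesis by simp
    qed
    then show ?thesis using N(2) by blast
  qed
  moreover have "midpoints f 1 b \<psi>"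
    using \<psi>(1) midpoints_mono[of f K b \<psi> 1 b] by (simp add: K_def)
  ultimately show ?thesis using \<psi>'(1) by blast
qed

text \<open>By the previous lemma some \<^term>\<open>f j\<close> is small at \<^term>\<open>x m - x 0\<close> with \<^term>\<open>(j::nat) < m\<close>. Then \<^term>\<open>f j\<close>
  and \<^term>\<open>\<lambda>z::'a. - f m z\<close> both almost norm \<^term>\<open>x j - x m\<close>, so they are close, but they differ
  at \<^term>\<open>x j - x 0\<close>.\<close>

lemma no_long_diametral_sequence:
  assumes "d > 0"
  shows "\<exists>\<theta>>0. \<exists>N. \<forall>(x::nat \<Rightarrow> 'a) f. (\<forall>i. dual_ball (f i)) \<and>
      (\<forall>i\<le>N. \<forall>l<i. d * (1 - \<theta>) \<le> f i (x i - x l)) \<longrightarrow>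
      (\<exists>i\<le>N. \<exists>l\<le>N. d * (1 + \<theta>) < norm (x i - x l))"
proof -
  obtain \<delta> where "\<delta> > 0" and \<delta>: "\<And>\<psi> \<psi>' (x::'a) h. dual_ball \<psi> \<Longrightarrow> dual_ball \<psi>' \<Longrightarrow> norm x \<le> 1 \<Longrightarrow>
        \<psi> x \<ge> 1 - \<delta> \<Longrightarrow> \<psi>' x \<ge> 1 - \<delta> \<Longrightarrow> \<psi> h - \<psi>' h \<le> 1 / 2 * norm h"
    using dual_uniformly_convex[of "1 / 2"] by (metis half_gt_zero zero_less_one)
  \<comment> \<open>1/8 is below 1/7, the value at which the final inequality becomes possible;
    \<delta>/6 matches the total loss of \<open>6 * \<theta>\<close>.\<close>
  define \<theta> where "\<theta> = min (1/8) (\<delta> / 6)"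
  have \<theta>: "\<theta> > 0" "\<theta> \<le> 1/8" "6 * \<theta> \<le> \<delta>"
    using \<open>\<delta> > 0\<close> by (auto simp: \<theta>_def)
  define Q where "Q N x f \<longleftrightarrow> (\<forall>i. dual_ball (f i)) \<and>
      (\<forall>i\<le>N. \<forall>l<i. d * (1 - \<theta>) \<le> f i (x i - x l)) \<and> (\<forall>i\<le>N. \<forall>l\<le>N. norm (x i - x l) \<le> d * (1 + \<theta>))"
    for N :: nat and x :: "nat \<Rightarrow> 'a" and f
  have "\<not> (\<forall>N. \<exists>x f. Q N x f)"
  proof
    assume fam: "\<forall>N. \<exists>x f. Q N x f"
    obtain x g where Q: "\<And>N. Q N (x N) (g N)"
      using fam by metis
    have g: "dual_ball (g N i)"
      and far: "i \<le> N \<Longrightarrow> l < i \<Longrightarrow> d * (1 - \<theta>) \<le> g N i (x N i - x N l)"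
      and near: "i \<le> N \<Longrightarrow> l \<le> N \<Longrightarrow> norm (x N i - x N l) \<le> d * (1 + \<theta>)" for N i l
      using Q[of N] unfolding Q_def by simp_all
    obtain b c \<psi> \<psi>' N where mp: "midpoints (\<lambda>i N. g N i) 1 b \<psi>" "midpoints (\<lambda>i N. g N i) (b + 2) c \<psi>'"
      and N: "c \<le> N" and close: "\<And>z. \<psi> N z - \<psi>' N z \<le> \<theta> * norm z"
      using midpoints_close[of "\<lambda>i N. g N i", OF g \<theta>(1)] by blast
    define f y m where "f = g N" and "y = x N" and "m = b + 1"
    note db = g[of N, folded f_def]
    note d1 = dual_ballD(3,4)[OF db]
    have bc: "b + 2 \<le> c"
      using midpoints_lower[OF mp(2)] by force
    then have m: "m \<le> N"
      using N by (simp add: m_def)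
    \<comment> \<open>A later \<open>f i\<close> is almost \<open>d\<close> on both
      \<open>y i - y 0\<close> and \<open>y i - y m\<close>, hence small on
      \<open>y m - y 0\<close>. Smallness there passes to \<psi>', by closeness to \<psi>, and from
      \<psi> to some earlier \<open>f j\<close>.\<close>
    obtain i where i: "b + 2 \<le> i" "i \<le> c" "\<psi>' N (y m - y 0) \<le> f i (y m - y 0)"
      using midpoints_upper[OF mp(2), of N "y m - y 0"] by (auto simp: f_def)
    have "f i (y i - y 0) \<le> d * (1 + \<theta>)"
      using dual_ballD(2)[OF db, of i "y i - y 0"] near[of i N 0] i N by (simp add: y_def)
    moreover have "d * (1 - \<theta>) \<le> f i (y i - y m)"
      using far[of i N m] i N by (simp add: y_def f_def m_def)
    ultimately have "f i (y m - y 0) \<le> 2 * \<theta> * d"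
      by (simp add: d1 algebra_simps)
    moreover have "\<psi> N (y m - y 0) - \<psi>' N (y m - y 0) \<le> \<theta> * (d * (1 + \<theta>))"
      using close[of "y m - y 0"] near[of m N 0] m \<theta>(1)
      by (auto simp: y_def intro: order_trans mult_left_mono)
    moreover obtain j where j: "1 \<le> j" "j \<le> b" "f j (y m - y 0) \<le> \<psi> N (y m - y 0)"
      using midpoints_lower[OF mp(1), of N "y m - y 0"] by (auto simp: f_def)
    ultimately have fj: "f j (y m - y 0) \<le> 2 * \<theta> * d + \<theta> * (d * (1 + \<theta>))"
      using i(3) by linarith
    have jm: "j < m" "j \<le> N" "0 < j"
      using j m by (auto simp: m_def)
    have j0: "d * (1 - \<theta>) \<le> f j (y j - y 0)"
      using far[of j N 0] jm by (simp add: f_def y_def)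
    have mj: "d * (1 - \<theta>) \<le> f m (y m - y j)" and m0: "d * (1 - \<theta>) \<le> f m (y m - y 0)"
      using far[of m N j] far[of m N 0] jm m by (simp_all add: f_def y_def)
    have njm: "norm (y j - y m) \<le> d * (1 + \<theta>)" and nj0: "norm (y j - y 0) \<le> d * (1 + \<theta>)"
      and nmj: "norm (y m - y j) \<le> d * (1 + \<theta>)"
      using near[of j N m] near[of j N 0] near[of m N j] jm m by (simp_all add: y_def)
    define e where "e = d * (1 + \<theta>)"
    have e: "e > 0"
      using assms \<theta> by (simp add: e_def)
    have d\<theta>: "d * \<theta> * \<theta> \<le> d * \<theta>"
      using assms \<theta> by (simp add: mult_left_le)
    have low: "e * (1 - 6 * \<theta>) \<le> d * (1 - 5 * \<theta>)"
      using assms \<theta>(1) by (simp add: e_def algebra_simps)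
    define u where "u = (1 / e) *\<^sub>R (y j - y m)"
    have "norm u \<le> 1"
      using njm e by (simp add: u_def e_def[symmetric] pos_divide_le_eq)
    moreover have "1 - \<delta> \<le> f j u"
    proof -
      have "d * (1 - 5 * \<theta>) \<le> f j (y j - y m)"
        using fj j0 d\<theta> by (simp add: d1 algebra_simps)
      then have "e * (1 - 6 * \<theta>) \<le> f j (y j - y m)"
        using low by simp
      then have "1 - 6 * \<theta> \<le> f j u"
        using e by (simp add: u_def dual_ballD[OF db] field_simps)
      then show ?thesis using \<theta>(3) by simp
    qed
    moreover have "1 - \<delta> \<le> - f m u"
    proof -
      have "d * (1 - 5 * \<theta>) \<le> - f m (y j - y m)"
        using mj mult_pos_pos[OF assms \<theta>(1)] by (simp add: d1 algebra_simps)
      then have "e * (1 - 6 * \<theta>) \<le> - f m (y j - y m)"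
        using low by simp
      then have "1 - 6 * \<theta> \<le> - f m u"
        using e by (simp add: u_def dual_ballD[OF db] field_simps)
      then show ?thesis using \<theta>(3) by simp
    qed
    \<comment> \<open>\<open>f j\<close> and \<open>- f m\<close> both almost norm \<open>u\<close>,
      so they are close. Yet on \<open>y j - y 0\<close> the former is almost \<open>d\<close>,
      while \<open>f m\<close> is bounded below by a small negative multiple of \<open>d\<close>,
      being almost \<open>d\<close> on \<open>y m - y 0\<close> and on
      \<open>y m - y j\<close>.\<close>
    ultimately have "f j (y j - y 0) + f m (y j - y 0) \<le> 1 / 2 * norm (y j - y 0)"
      using \<delta>[OF db dual_ball_minus[OF db], of u j m "y j - y 0"] by simp
    moreover have "f m (y m - y j) \<le> d * (1 + \<theta>)"
      using dual_ballD(2)[OF db, of m "y m - y j"] nmj by simp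
    ultimately have "d * (1 - 3 * \<theta>) \<le> 1 / 2 * (d * (1 + \<theta>))"
      using j0 m0 nj0 by (simp add: d1 algebra_simps)
    then have "d * (1 - 3 * \<theta>) \<le> d * ((1 + \<theta>) / 2)"
      by simp
    then have "1 - 3 * \<theta> \<le> (1 + \<theta>) / 2"
      using assms by (simp only: mult_le_cancel_left_pos)
    then show False using \<theta>(2) by simp
  qed
  then obtain N where N: "\<not> (\<exists>x f. Q N x f)"
    unfolding not_all by (rule exE)
  have key: "\<exists>i\<le>N. \<exists>l\<le>N. d * (1 + \<theta>) < norm (x i - x l)"
    if "(\<forall>i. dual_ball (f i)) \<and> (\<forall>i\<le>N. \<forall>l<i. d * (1 - \<theta>) \<le> f i (x i - x l))" for x :: "nat \<Rightarrow> 'a" and f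
  proof (rule ccontr)
    assume "\<not> ?thesis"
    then have "Q N x f"
      using that by (simp add: Q_def not_less)
    then show False
      using N by blast
  qed
  show ?thesis
    by (rule exI[of _ \<theta>], rule conjI[OF \<theta>(1)], rule exI[of _ N]) (intro allI impI, rule key)
qed

text \<open>If uniform convexity fails, \<^term>\<open>d\<close> is the limit diameter of small slices. All these slices
  are congruent by transitivity, so a point at distance almost \<^term>\<open>d\<close> can be found from the
  average of any points of a thin slice, in a thin slice with almost the same functional.\<close>

lemma uniformly_convex:
  assumes "\<epsilon> > 0"
  shows "\<exists>\<delta>>0. \<forall>(x::'a) \<phi> y. norm x = 1 \<and> dual_ball \<phi> \<and> \<phi> x = 1 \<and> norm y \<le> 1 \<and> 1 - \<delta> \<le> \<phi> y \<longrightarrow>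
    norm (x - y) < \<epsilon>"
proof (rule ccontr)
  assume neg: "\<not> ?thesis"
  \<comment> \<open>The distances from the centre that survive in arbitrarily thin slices; failure
    of the claim puts \<epsilon> among them.\<close>
  define A where "A = {e. \<forall>\<delta>>0. \<exists>(x::'a) \<phi> y. norm x = 1 \<and> dual_ball \<phi> \<and> \<phi> x = 1 \<and> norm y \<le> 1 \<and>
    1 - \<delta> \<le> \<phi> y \<and> e \<le> norm (x - y)}"
  define d where "d = Sup A"
  have "\<epsilon> \<in> A"
    using neg unfolding A_def by (force simp: not_less)
  have "e \<le> 2" if e: "e \<in> A" for e
  proof -
    obtain x y :: 'a where "norm x = 1" "norm y \<le> 1" "e \<le> norm (x - y)"
      using e[unfolded A_def, simplified, rule_format, OF zero_less_one] by blast
    then show ?thesis using norm_triangle_ineq4[of x y] by simp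
  qed
  then have bdd: "bdd_above A"
    by (intro bdd_aboveI[of _ 2]) auto
  have "d > 0"
    using cSup_upper[OF \<open>\<epsilon> \<in> A\<close> bdd] \<open>\<epsilon> > 0\<close> by (simp add: d_def)
  \<comment> \<open>Membership in \<open>A\<close> only provides some slice. An isometry carries its
    centre to \<open>x\<close>, and uniqueness of supports carries its functional to \<phi>.\<close>
  have far: "\<exists>y. norm y \<le> 1 \<and> 1 - \<delta> \<le> \<phi> y \<and> d * (1 - \<kappa>) < norm (x - y)"
    if x: "norm x = 1" "dual_ball \<phi>" "\<phi> x = 1" and pos: "\<delta> > 0" "\<kappa> > 0" for x :: 'a and \<phi> \<delta> \<kappa>
  proof -
    have "d * (1 - \<kappa>) < d"
      using \<open>d > 0\<close> pos by (simp add: algebra_simps)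
    then obtain e where e: "e \<in> A" "d * (1 - \<kappa>) < e"
      using less_cSupD[of A "d * (1 - \<kappa>)"] \<open>\<epsilon> \<in> A\<close> unfolding d_def[symmetric] by blast
    from e(1) pos(1) have "\<exists>(x::'a) \<phi> y. norm x = 1 \<and> dual_ball \<phi> \<and> \<phi> x = 1 \<and> norm y \<le> 1 \<and>
        1 - \<delta> \<le> \<phi> y \<and> e \<le> norm (x - y)"
      by (simp add: A_def)
    then obtain x' y :: 'a and \<phi>' where y: "norm x' = 1" "dual_ball \<phi>'" "\<phi>' x' = 1" "norm y \<le> 1" "1 - \<delta> \<le> \<phi>' y"
      "e \<le> norm (x' - y)"
      by blast
    obtain g where g: "g \<in> G" "g x = x'"
      using transitive[OF x(1) y(1)] by blast
    obtain h where h: "h \<in> G" "\<And>x. g (h x) = x" "\<And>x. h (g x) = x"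
      using inverse[OF g(1)] by blast
    have "\<phi> = \<phi>' \<circ> g"
      using support_unique[OF x dual_ball_comp[OF y(2) g(1)]] g(2) y(3) by simp
    moreover have "x - h y = h (x' - y)"
      using g(2) h(3)[of x] lin[OF h(1)] by (simp add: linear_diff)
    then have "norm (x - h y) = norm (x' - y)"
      using isom[OF h(1)] by simp
    ultimately show ?thesis
      using y e(2) h(2) isom[OF h(1)] by (intro exI[of _ "h y"]) auto
  qed
  \<comment> \<open>\<open>d\<close> controls distances from the centre only. Normalising
    \<open>y\<close> makes it a centre itself; its support is close to \<phi>, so \<open>z\<close>
    lies in a thin slice around it.\<close>
  have pairs: "\<exists>\<sigma>>0. \<forall>(p::'a) \<phi> y z. norm p = 1 \<and> dual_ball \<phi> \<and> \<phi> p = 1 \<and> norm y \<le> 1 \<and> norm z \<le> 1 \<and>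
      1 - \<sigma> \<le> \<phi> y \<and> 1 - \<sigma> \<le> \<phi> z \<longrightarrow> norm (y - z) \<le> d * (1 + \<kappa>)" if \<kappa>: "\<kappa> > 0" for \<kappa>
  proof -
    have "d * (1 + \<kappa> / 2) > d"
      using \<open>d > 0\<close> \<kappa> by simp
    then have "d * (1 + \<kappa> / 2) \<notin> A"
      using cSup_upper[OF _ bdd] by (force simp: d_def)
    then obtain \<delta> where "\<delta> > 0" and \<delta>: "\<And>(x::'a) \<phi> y. norm x = 1 \<Longrightarrow> dual_ball \<phi> \<Longrightarrow> \<phi> x = 1 \<Longrightarrow> norm y \<le> 1 \<Longrightarrow>
      1 - \<delta> \<le> \<phi> y \<Longrightarrow> norm (x - y) < d * (1 + \<kappa> / 2)"
      unfolding A_def by (force simp: not_le)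
    obtain \<gamma> where "\<gamma> > 0" and \<gamma>: "\<And>\<psi> \<psi>' (x::'a) h. dual_ball \<psi> \<Longrightarrow> dual_ball \<psi>' \<Longrightarrow> norm x \<le> 1 \<Longrightarrow>
        \<psi> x \<ge> 1 - \<gamma> \<Longrightarrow> \<psi>' x \<ge> 1 - \<gamma> \<Longrightarrow> \<psi> h - \<psi>' h \<le> \<delta> / 2 * norm h"
      using dual_uniformly_convex[of "\<delta> / 2"] \<open>\<delta> > 0\<close> by (metis half_gt_zero)
    define \<sigma> where "\<sigma> = min (min (\<delta> / 2) \<gamma>) (min (d * \<kappa> / 2) (1 / 2))"
    have \<sigma>: "\<sigma> > 0" "\<sigma> \<le> \<delta> / 2" "\<sigma> \<le> \<gamma>" "\<sigma> \<le> d * \<kappa> / 2" "\<sigma> \<le> 1 / 2"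
      using \<open>\<delta> > 0\<close> \<open>\<gamma> > 0\<close> \<open>d > 0\<close> \<kappa> by (auto simp: \<sigma>_def)
    have "norm (y - z) \<le> d * (1 + \<kappa>)"
      if *: "norm p = 1" "dual_ball \<phi>" "\<phi> p = 1" "norm y \<le> 1" "norm z \<le> 1" "1 - \<sigma> \<le> \<phi> y" "1 - \<sigma> \<le> \<phi> z"
      for p y z :: 'a and \<phi>
    proof -
      have y: "1 - \<sigma> \<le> norm y"
        using *(6) dual_ballD(2)[OF *(2), of y] by simp
      then have "y \<noteq> 0"
        using \<sigma> by auto
      obtain h where h: "dual_ball h" "h y = norm y"
        using support_exists by blast
      have u: "norm (sgn y) = 1" "h (sgn y) = 1"
        using \<open>y \<noteq> 0\<close> h by (simp_all add: norm_sgn sgn_div_norm dual_ballD)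
      have "\<phi> z - h z \<le> \<delta> / 2 * norm z"
        using \<gamma>[OF *(2) h(1) *(4), of z] *(6) h(2) y \<sigma>(3) by simp
      also have "\<dots> \<le> \<delta> / 2"
        using *(5) \<open>\<delta> > 0\<close> by simp
      finally have "1 - \<delta> \<le> h z"
        using *(7) \<sigma>(2) by simp
      then have "norm (sgn y - z) < d * (1 + \<kappa> / 2)"
        using \<delta>[OF u(1) h(1) u(2) *(5)] by simp
      moreover have "norm (y - sgn y) \<le> d * \<kappa> / 2"
        using norm_sgn_minus_self[OF *(4) \<open>y \<noteq> 0\<close>] y \<sigma>(4) by (simp add: norm_minus_commute)
      ultimately show ?thesis
        using norm_triangle_ineq[of "y - sgn y" "sgn y - z"] by (simp add: algebra_simps)
    qed
    then show ?thesis using \<sigma>(1) by blast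
  qed
  obtain \<theta> N where "\<theta> > 0" and no: "\<forall>(x::nat \<Rightarrow> 'a) f. (\<forall>i. dual_ball (f i)) \<and>
      (\<forall>i\<le>N. \<forall>l<i. d * (1 - \<theta>) \<le> f i (x i - x l)) \<longrightarrow>
      (\<exists>i\<le>N. \<exists>l\<le>N. d * (1 + \<theta>) < norm (x i - x l))"
    using no_long_diametral_sequence[OF \<open>d > 0\<close>] by (elim exE conjE)
  \<comment> \<open>Slice membership will bound mutual distances from above through
    \<open>pairs\<close>; the \<open>f i\<close> bound them from below.\<close>
  define Q where "Q n \<sigma> p \<phi> x f \<longleftrightarrow> norm p = 1 \<and> dual_ball \<phi> \<and> \<phi> p = 1 \<and> (\<forall>i. dual_ball (f i)) \<and>
      (\<forall>i\<le>n. norm (x i) \<le> 1 \<and> 1 - \<sigma> \<le> \<phi> (x i)) \<and>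
      (\<forall>i\<le>n. \<forall>l<i. d * (1 - \<theta>) \<le> f i (x i - x l))" for n :: nat and \<sigma> and p :: 'a and \<phi> x f
  \<comment> \<open>The thickness \<sigma> is arbitrary, since each extension starts from a shorter
    sequence in a thinner slice.\<close>
  have build: "\<exists>p \<phi> x f. Q n \<sigma> p \<phi> x f" if "\<sigma> > 0" for n \<sigma>
    using that
  proof (induction n arbitrary: \<sigma>)
    case 0
    then show ?case
      using base unfolding Q_def by (intro exI[of _ x\<^sub>0] exI[of _ \<phi>\<^sub>0] exI[of _ "\<lambda>_. x\<^sub>0"] exI[of _ "\<lambda>_. \<phi>\<^sub>0"]) auto
  next
    case (Suc n)
    \<comment> \<open>Passing from an average of \<open>n + 1\<close> values to a single one
      multiplies the error by less than \<open>2 * (n + 1)\<close>.\<close>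
    define \<kappa> where "\<kappa> = \<theta> / (2 * real (Suc n))"
    have \<kappa>: "\<kappa> > 0" "2 * real (Suc n) * \<kappa> = \<theta>"
      using \<open>\<theta> > 0\<close> by (auto simp: \<kappa>_def)
    obtain \<sigma>\<^sub>2 where "\<sigma>\<^sub>2 > 0" and near: "\<And>(p::'a) \<phi> y z. norm p = 1 \<Longrightarrow> dual_ball \<phi> \<Longrightarrow> \<phi> p = 1 \<Longrightarrow>
      norm y \<le> 1 \<Longrightarrow> norm z \<le> 1 \<Longrightarrow> 1 - \<sigma>\<^sub>2 \<le> \<phi> y \<Longrightarrow> 1 - \<sigma>\<^sub>2 \<le> \<phi> z \<Longrightarrow> norm (y - z) \<le> d * (1 + \<kappa>)"
      using pairs[OF \<kappa>(1)] by blast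
    define s where "s = min \<sigma> \<sigma>\<^sub>2"
    have s: "s > 0" "s \<le> \<sigma>" "s \<le> \<sigma>\<^sub>2"
      using Suc.prems \<open>\<sigma>\<^sub>2 > 0\<close> by (auto simp: s_def)
    obtain \<gamma> where "\<gamma> > 0" and \<gamma>: "\<And>\<psi> \<psi>' (x::'a) h. dual_ball \<psi> \<Longrightarrow> dual_ball \<psi>' \<Longrightarrow> norm x \<le> 1 \<Longrightarrow>
        \<psi> x \<ge> 1 - \<gamma> \<Longrightarrow> \<psi>' x \<ge> 1 - \<gamma> \<Longrightarrow> \<psi> h - \<psi>' h \<le> s / 2 * norm h"
      using dual_uniformly_convex[of "s / 2"] s(1) by (metis half_gt_zero)
    \<comment> \<open>The first two bounds keep the old points in the slice of thickness
      \<open>s\<close> at the new centre; the third pays for normalising the average, and 1/2 keeps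
      it nonzero.\<close>
    define \<sigma>' where "\<sigma>' = min (min (s / 2) \<gamma>) (min (d * \<kappa> / 2) (1 / 2))"
    have \<sigma>': "\<sigma>' > 0" "\<sigma>' \<le> s / 2" "\<sigma>' \<le> \<gamma>" "\<sigma>' \<le> d * \<kappa> / 2" "\<sigma>' \<le> 1 / 2"
      using \<open>\<gamma> > 0\<close> \<open>d > 0\<close> \<kappa>(1) s by (auto simp: \<sigma>'_def)
    obtain p \<phi> x f where "Q n \<sigma>' p \<phi> x f"
      using Suc.IH[OF \<sigma>'(1)] by blast
    then have p: "norm p = 1" "dual_ball \<phi>" "\<phi> p = 1" and f: "\<And>i. dual_ball (f i)"
      and x: "\<And>i. i \<le> n \<Longrightarrow> norm (x i) \<le> 1" "\<And>i. i \<le> n \<Longrightarrow> 1 - \<sigma>' \<le> \<phi> (x i)"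
      and fx: "\<And>i l. i \<le> n \<Longrightarrow> l < i \<Longrightarrow> d * (1 - \<theta>) \<le> f i (x i - x l)"
      by (simp_all add: Q_def)
    define c where "c = (1 / real (Suc n)) *\<^sub>R (\<Sum>i\<le>n. x i)"
    have avg: "\<psi> c = (\<Sum>i\<le>n. \<psi> (x i)) / real (Suc n)" if "dual_ball \<psi>" for \<psi>
      using that by (simp add: c_def dual_ballD linear_sum sum_divide_distrib del: of_nat_Suc)
    have "norm (\<Sum>i\<le>n. x i) \<le> (\<Sum>i\<le>n. 1)"
      using x(1) by (intro sum_norm_le) auto
    then have c1: "norm c \<le> 1"
      by (simp add: c_def pos_divide_le_eq del: of_nat_Suc)
    have "(\<Sum>i\<le>n. 1 - \<sigma>') \<le> (\<Sum>i\<le>n. \<phi> (x i))"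
      using x(2) by (intro sum_mono) auto
    then have \<phi>c: "1 - \<sigma>' \<le> \<phi> c"
      by (simp add: avg[OF p(2)] pos_le_divide_eq mult.commute[of _ "real (Suc n)"] del: of_nat_Suc)
    then have nc: "1 - \<sigma>' \<le> norm c"
      using dual_ballD(2)[OF p(2), of c] by simp
    then have "c \<noteq> 0"
      using \<sigma>' by auto
    obtain h where h: "dual_ball h" "h c = norm c"
      using support_exists by blast
    have u: "norm (sgn c) = 1" "h (sgn c) = 1"
      using \<open>c \<noteq> 0\<close> h by (simp_all add: norm_sgn sgn_div_norm dual_ballD)
    have hx: "1 - s \<le> h (x i)" if "i \<le> n" for i
    proof -
      have "\<phi> (x i) - h (x i) \<le> s / 2 * norm (x i)"
        using \<gamma>[OF p(2) h(1) c1, of "x i"] \<phi>c h(2) nc \<sigma>'(3) by simp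
      also have "\<dots> \<le> s / 2"
        using x(1)[OF that] s(1) by simp
      finally show ?thesis
        using x(2)[OF that] \<sigma>'(2) by simp
    qed
    obtain z where z: "norm z \<le> 1" "1 - s \<le> h z" "d * (1 - \<kappa> / 2) < norm (sgn c - z)"
      using far[OF u(1) h(1) u(2) s(1), of "\<kappa> / 2"] \<kappa>(1) by auto
    have "norm (sgn c - c) \<le> d * \<kappa> / 2"
      using norm_sgn_minus_self[OF c1 \<open>c \<noteq> 0\<close>] nc \<sigma>'(4) by simp
    then have zc: "d * (1 - \<kappa>) \<le> norm (z - c)"
      using z(3) norm_triangle_ineq[of "sgn c - c" "c - z"] by (simp add: norm_minus_commute algebra_simps)
    obtain \<psi> where \<psi>: "dual_ball \<psi>" "\<psi> (z - c) = norm (z - c)"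
      using support_exists by blast
    \<comment> \<open>The values \<open>\<psi> (z - x i)\<close> average at least
      \<open>d * (1 - \<kappa>)\<close> and none exceeds \<open>d * (1 + \<kappa>)\<close>, so none
      can be much smaller.\<close>
    have far_z: "d * (1 - \<theta>) \<le> \<psi> (z - x l)" if "l \<le> n" for l
    proof -
      have up: "\<psi> (z - x i) \<le> d * (1 + \<kappa>)" if "i \<le> n" for i
        using dual_ballD(2)[OF \<psi>(1), of "z - x i"] near[OF u(1) h(1) u(2) z(1) x(1)[OF that]] s(3) z(2)
          hx[OF that] by simp
      have "(\<Sum>i\<le>n. \<psi> (z - x i)) = real (Suc n) * \<psi> (z - c)"
        by (simp add: dual_ballD[OF \<psi>(1)] avg[OF \<psi>(1)] sum_subtractf right_diff_distrib del: of_nat_Suc)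
      then have "real (Suc n) * (d * (1 - \<kappa>)) \<le> (\<Sum>i\<le>n. \<psi> (z - x i))"
        using zc \<psi>(2) by (simp only: mult_left_mono of_nat_0_le_iff)
      also have "\<dots> = \<psi> (z - x l) + (\<Sum>i\<in>{..n} - {l}. \<psi> (z - x i))"
        using that by (intro sum.remove) auto
      also have "(\<Sum>i\<in>{..n} - {l}. \<psi> (z - x i)) \<le> (\<Sum>i\<in>{..n} - {l}. d * (1 + \<kappa>))"
        using up by (intro sum_mono) auto
      also have "\<dots> = real n * (d * (1 + \<kappa>))"
        using that by (simp add: card_Diff_subset)
      finally have "d * (1 - (2 * real (Suc n) - 1) * \<kappa>) \<le> \<psi> (z - x l)"
        by (simp add: algebra_simps)
      moreover have "d * (1 - \<theta>) \<le> d * (1 - (2 * real (Suc n) - 1) * \<kappa>)"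
        using \<kappa> \<open>d > 0\<close> by (intro mult_left_mono) (auto simp: algebra_simps)
      ultimately show ?thesis by simp
    qed
    define x' f' where "x' = x(Suc n := z)" and "f' = f(Suc n := \<psi>)"
    have "\<forall>i. dual_ball (f' i)"
      using f \<psi>(1) by (simp add: f'_def)
    moreover have "\<forall>i\<le>Suc n. norm (x' i) \<le> 1 \<and> 1 - \<sigma> \<le> h (x' i)"
      using x(1) z hx s(2) by (auto simp: x'_def le_Suc_eq intro: order_trans[of _ "1 - s"])
    moreover have "\<forall>i\<le>Suc n. \<forall>l<i. d * (1 - \<theta>) \<le> f' i (x' i - x' l)"
      using fx far_z by (auto simp: x'_def f'_def le_Suc_eq)
    ultimately show ?case
      using u h(1) unfolding Q_def
      by (intro exI[of _ "sgn c"] exI[of _ h] exI[of _ x'] exI[of _ f'] conjI) assumption+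
  qed
  obtain \<sigma> where "\<sigma> > 0" and near: "\<And>(p::'a) \<phi> y z. norm p = 1 \<Longrightarrow> dual_ball \<phi> \<Longrightarrow> \<phi> p = 1 \<Longrightarrow>
      norm y \<le> 1 \<Longrightarrow> norm z \<le> 1 \<Longrightarrow> 1 - \<sigma> \<le> \<phi> y \<Longrightarrow> 1 - \<sigma> \<le> \<phi> z \<Longrightarrow> norm (y - z) \<le> d * (1 + \<theta>)"
    using pairs[OF \<open>\<theta> > 0\<close>] by blast
  obtain p \<phi> x f where "Q N \<sigma> p \<phi> x f"
    using build[OF \<open>\<sigma> > 0\<close>, of N] by blast
  then have p: "norm p = 1" "dual_ball \<phi>" "\<phi> p = 1" and f: "\<And>i. dual_ball (f i)"
    and x: "\<And>i. i \<le> N \<Longrightarrow> norm (x i) \<le> 1" "\<And>i. i \<le> N \<Longrightarrow> 1 - \<sigma> \<le> \<phi> (x i)"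
    and fx: "\<And>i l. i \<le> N \<Longrightarrow> l < i \<Longrightarrow> d * (1 - \<theta>) \<le> f i (x i - x l)"
    by (simp_all add: Q_def)
  obtain i l where "i \<le> N" "l \<le> N" "d * (1 + \<theta>) < norm (x i - x l)"
    using no[rule_format, of f x] f fx by blast
  then show False
    using near[OF p x(1) x(1) x(2) x(2), of i l] by simp
qed

end

section \<open>Attaining the numerical radius\<close>

text \<open>The map \<^term>\<open>re\<close> is the real part; it allows a common treatment of both scalar fields.\<close>

locale scaled_space =
  fixes sc :: "'k::real_normed_field \<Rightarrow> 'a::banach \<Rightarrow> 'a" and re :: "'k \<Rightarrow> real"
  assumes scaling: "K_scaling sc"
    and re_linear: "linear re"
    and re_one: "re 1 = 1"
    and re_le_norm: "re a \<le> norm a"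
    and re_rotate: "\<exists>u. norm u = 1 \<and> re (u * a) = norm a"
begin

lemma sc_mult: "sc a (sc b x) = sc (a * b) x"
  and sc_add_right: "sc a (x + y) = sc a x + sc a y"
  and sc_add_left: "sc (a + b) x = sc a x + sc b x"
  and sc_of_real: "sc (of_real r) x = r *\<^sub>R x"
  and norm_sc: "norm (sc a x) = norm a * norm x"
  using scaling by (simp_all add: K_scaling_def)

lemma sc_one [simp]: "sc 1 x = x"
  using sc_of_real[of 1 x] by simp

lemma sc_scaleR: "sc a (r *\<^sub>R x) = r *\<^sub>R sc a x"
  by (simp add: sc_of_real[symmetric] sc_mult mult.commute)

lemma bounded_linear_sc: "bounded_linear (sc a)"
  by (rule bounded_linear_intro[where K = "norm a"])
     (simp_all add: sc_add_right sc_scaleR norm_sc mult.commute)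

lemma sc_minus: "sc a (- x) = - sc a x"
  and sc_diff: "sc a (x - y) = sc a x - sc a y"
  using bounded_linear.linear[OF bounded_linear_sc] by (simp_all add: linear_neg linear_diff)

lemma bounded_linear_sc_left: "bounded_linear (\<lambda>a. sc a x)"
proof (rule bounded_linear_intro[where K = "norm x"])
  show "sc (r *\<^sub>R a) x = r *\<^sub>R sc a x" for r a
    by (simp add: scaleR_conv_of_real sc_mult[symmetric] sc_of_real)
qed (simp_all add: sc_add_left norm_sc)

lemma KlinearD:
  assumes "Klinear sc T"
  shows "bounded_linear T" "linear T" "T (sc c x) = sc c (T x)" "T (x + y) = T x + T y"
    "T (x - y) = T x - T y" "T (- x) = - T x" "T (r *\<^sub>R x) = r *\<^sub>R T x"
proof -
  show *: "bounded_linear T"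
    using assms by (simp add: Klinear_def)
  then show "linear T" "T (x + y) = T x + T y" "T (x - y) = T x - T y" "T (- x) = - T x"
    "T (r *\<^sub>R x) = r *\<^sub>R T x"
    by (simp_all add: bounded_linear.linear linear_add linear_diff linear_neg linear_scale)
  show "T (sc c x) = sc c (T x)"
    using assms by (simp add: Klinear_def)
qed

lemma KfunctionalD:
  assumes "Kfunctional sc f"
  shows "bounded_linear f" "linear f" "f (sc c x) = c * f x" "f (x + y) = f x + f y"
    "f (x - y) = f x - f y" "f (r *\<^sub>R x) = r *\<^sub>R f x"
proof -
  show *: "bounded_linear f"
    using assms by (simp add: Kfunctional_def)
  then show "linear f" "f (x + y) = f x + f y" "f (x - y) = f x - f y" "f (r *\<^sub>R x) = r *\<^sub>R f x"
    by (simp_all add: bounded_linear.linear linear_add linear_diff linear_scale)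
  show "f (sc c x) = c * f x"
    using assms by (simp add: Kfunctional_def)
qed

lemma Klinear_comp:
  assumes "Klinear sc S" "Klinear sc T"
  shows "Klinear sc (\<lambda>x. S (T x))"
  using assms by (simp add: Klinear_def bounded_linear_compose)

lemma Klinear_add:
  assumes "Klinear sc S" "Klinear sc T"
  shows "Klinear sc (\<lambda>x. S x + T x)"
  using assms by (simp add: Klinear_def bounded_linear_add sc_add_right)

lemma Klinear_diff:
  assumes "Klinear sc S" "Klinear sc T"
  shows "Klinear sc (\<lambda>x. S x - T x)"
  using assms by (simp add: Klinear_def bounded_linear_sub sc_diff)

lemma Klinear_scaleR:
  assumes "Klinear sc T"
  shows "Klinear sc (\<lambda>x. r *\<^sub>R T x)"
  using assms by (simp add: Klinear_def bounded_linear_compose[OF bounded_linear_scaleR_right] sc_scaleR)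

lemma Klinear_rank_one:
  assumes "Kfunctional sc f"
  shows "Klinear sc (\<lambda>z. sc (a * f z) x)"
proof -
  have "bounded_linear (\<lambda>z. a * f z)"
    using KfunctionalD(1)[OF assms] by (rule bounded_linear_const_mult)
  from bounded_linear_compose[OF bounded_linear_sc_left[of x] this]
  show ?thesis
    by (simp add: Klinear_def sc_mult KfunctionalD[OF assms] mult_ac)
qed

lemma states_iff:
  "(x, f) \<in> states sc \<longleftrightarrow> norm x = 1 \<and> Kfunctional sc f \<and> (\<forall>z. norm (f z) \<le> norm z) \<and> f x = 1"
proof
  assume "(x, f) \<in> states sc"
  then have *: "norm x = 1" "Kfunctional sc f" "onorm f = 1" "f x = 1"
    by (auto simp: states_def)
  then show "norm x = 1 \<and> Kfunctional sc f \<and> (\<forall>z. norm (f z) \<le> norm z) \<and> f x = 1"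
    using onorm[OF KfunctionalD(1)[OF *(2)]] by simp
next
  assume *: "norm x = 1 \<and> Kfunctional sc f \<and> (\<forall>z. norm (f z) \<le> norm z) \<and> f x = 1"
  then have "onorm f \<le> 1"
    by (intro onorm_bound) auto
  moreover have "1 \<le> onorm f"
    using * onorm[of f x] KfunctionalD(1) by auto
  ultimately show "(x, f) \<in> states sc"
    using * by (simp add: states_def)
qed

lemma stateD:
  assumes "(x, f) \<in> states sc"
  shows "norm x = 1" "Kfunctional sc f" "norm (f z) \<le> norm z" "f x = 1"
  using assms by (auto simp: states_iff)

lemma state_dual_ball:
  assumes "(x, f) \<in> states sc"
  shows "dual_ball (\<lambda>z. re (f z))"
  unfolding dual_ball_def
proof (intro conjI allI)
  show "linear (\<lambda>z. re (f z))"
    using linear_compose[OF KfunctionalD(2)[OF stateD(2)[OF assms]] re_linear] by (simp add: o_def)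
  show "re (f z) \<le> norm z" for z
    using re_le_norm[of "f z"] stateD(3)[OF assms, of z] by simp
qed

text \<open>Rotating point and functional inversely lets a state be chosen whose point has a
  prescribed phase under another functional.\<close>

lemma state_rotate:
  assumes "(x, f) \<in> states sc" "norm u = 1"
  shows "(sc u x, \<lambda>z. f (sc (inverse u) z)) \<in> states sc"
proof -
  note f = stateD[OF assms(1)]
  have "Kfunctional sc (\<lambda>z. f (sc (inverse u) z))"
    using bounded_linear_compose[OF KfunctionalD(1)[OF f(2)] bounded_linear_sc[of "inverse u"]]
    by (simp add: Kfunctional_def sc_mult KfunctionalD[OF f(2)] mult_ac)
  moreover have "norm (f (sc (inverse u) z)) \<le> norm z" for z
    using f(3)[of "sc (inverse u) z"] assms(2) by (simp add: norm_sc norm_inverse)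
  moreover have "u \<noteq> 0"
    using assms(2) by auto
  ultimately show ?thesis
    using f assms(2) by (simp add: states_iff norm_sc sc_mult)
qed

lemma isometry_groupD:
  assumes "g \<in> isometry_group sc"
  shows "Klinear sc g" "surj g" "norm (g x) = norm x"
  using assms by (auto simp: isometry_group_def)

lemma state_isometry:
  assumes "(x, f) \<in> states sc" "g \<in> isometry_group sc" "g y = x"
  shows "(y, \<lambda>z. f (g z)) \<in> states sc"
proof -
  note f = stateD[OF assms(1)] and g = isometry_groupD[OF assms(2)]
  have "Kfunctional sc (\<lambda>z. f (g z))"
    using bounded_linear_compose[OF KfunctionalD(1)[OF f(2)] KlinearD(1)[OF g(1)]]
    by (simp add: Kfunctional_def KlinearD[OF g(1)] KfunctionalD[OF f(2)])
  moreover have "norm (f (g z)) \<le> norm z" for z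
    using f(3)[of "g z"] g(3)[of z] by simp
  ultimately show ?thesis
    using f g(3)[of y] assms(3) by (simp add: states_iff)
qed

lemma isometry_group_inverse:
  assumes "g \<in> isometry_group sc"
  shows "\<exists>h\<in>isometry_group sc. \<forall>x. g (h x) = x \<and> h (g x) = x"
proof -
  note g = isometry_groupD[OF assms]
  have "inj g"
  proof (rule injI)
    fix x y assume "g x = g y"
    then have "norm (x - y) = 0"
      using g(3)[of "x - y"] by (simp add: KlinearD[OF g(1)])
    then show "x = y" by simp
  qed
  define h where "h = inv g"
  have gh: "g (h x) = x" and hg: "h (g x) = x" for x
    using surj_f_inv_f[OF g(2)] inv_f_f[OF \<open>inj g\<close>] by (simp_all add: h_def)
  have nh: "norm (h x) = norm x" for x
    using g(3)[of "h x"] gh by simp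
  have "bounded_linear h"
  proof (rule bounded_linear_intro[where K = 1])
    show "h (x + y) = h x + h y" for x y
      by (rule injD[OF \<open>inj g\<close>]) (simp add: gh KlinearD[OF g(1)])
    show "h (r *\<^sub>R x) = r *\<^sub>R h x" for r x
      by (rule injD[OF \<open>inj g\<close>]) (simp add: gh KlinearD[OF g(1)])
  qed (simp add: nh)
  moreover have "h (sc c x) = sc c (h x)" for c x
    by (rule injD[OF \<open>inj g\<close>]) (simp add: gh KlinearD[OF g(1)])
  moreover have "surj h"
    by (rule surjI[of h g]) (rule hg)
  ultimately have "h \<in> isometry_group sc"
    by (simp add: isometry_group_def Klinear_def nh)
  then show ?thesis using gh hg by blast
qed

end

section \<open>The isometry group of a micro-transitive space\<close>

locale micro_transitive_space = scaled_space +
  fixes x\<^sub>0 f\<^sub>0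
  assumes base_state: "(x\<^sub>0, f\<^sub>0) \<in> states sc"
    and micro_transitive: "micro_transitive sc"

sublocale micro_transitive_space \<subseteq>
  supported_micro_transitive_group "isometry_group sc" x\<^sub>0 "\<lambda>z. re (f\<^sub>0 z)"
proof unfold_locales
  show "g (x + y) = g x + g y" "g (r *\<^sub>R x) = r *\<^sub>R g x" if "g \<in> isometry_group sc" for g x y r
    using KlinearD[OF isometry_groupD(1)[OF that]] by simp_all
  show "norm (g x) = norm x" if "g \<in> isometry_group sc" for g x
    using isometry_groupD(3)[OF that] .
  show "\<exists>h\<in>isometry_group sc. \<forall>x. g (h x) = x \<and> h (g x) = x" if "g \<in> isometry_group sc" for g
    using isometry_group_inverse[OF that] .
  show "g \<circ> h \<in> isometry_group sc" if "g \<in> isometry_group sc" "h \<in> isometry_group sc" for g h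
    using isometry_groupD[OF that(1)] isometry_groupD[OF that(2)] Klinear_comp[of g h]
      comp_surj[of h g] by (simp add: isometry_group_def o_def)
  show "uminus \<in> isometry_group sc"
    using bounded_linear_minus[OF bounded_linear_ident]
    by (simp add: isometry_group_def Klinear_def sc_minus)
  show "\<exists>\<epsilon>>0. \<forall>y. norm y = 1 \<and> norm (y - x) < \<epsilon> \<longrightarrow>
      (\<exists>g\<in>isometry_group sc. (\<forall>z. norm (g z - z) \<le> \<delta> * norm z) \<and> g x = y)"
    if x: "norm x = 1" and \<delta>: "\<delta> > 0" for x \<delta>
  proof -
    obtain \<epsilon> where "\<epsilon> > 0" and \<epsilon>: "\<And>y. norm y = 1 \<Longrightarrow> norm (y - x) < \<epsilon> \<Longrightarrow>
        (\<exists>g\<in>isometry_group sc. onorm (\<lambda>z. g z - z) < \<delta> \<and> g x = y)"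
      using micro_transitive[unfolded micro_transitive_def, rule_format, OF x \<delta>] by auto
    have "\<exists>g\<in>isometry_group sc. (\<forall>z. norm (g z - z) \<le> \<delta> * norm z) \<and> g x = y"
      if y: "norm y = 1" "norm (y - x) < \<epsilon>" for y
    proof -
      obtain g where g: "g \<in> isometry_group sc" "onorm (\<lambda>z. g z - z) < \<delta>" "g x = y"
        using \<epsilon>[OF y] by blast
      have bl: "bounded_linear (\<lambda>z. g z - z)"
        using isometry_groupD(1)[OF g(1)] by (intro bounded_linear_sub bounded_linear_ident KlinearD(1))
      have "norm (g z - z) \<le> \<delta> * norm z" for z
        using onorm[OF bl, of z] g(2) by (meson less_imp_le mult_right_mono norm_ge_zero order_trans)
      then show ?thesis using g by blast
    qed
    then show ?thesis using \<open>\<epsilon> > 0\<close> by blast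
  qed
  show "norm x\<^sub>0 = 1" "re (f\<^sub>0 x\<^sub>0) = 1" "dual_ball (\<lambda>z. re (f\<^sub>0 z))"
    using stateD[OF base_state] re_one state_dual_ball[OF base_state] by simp_all
qed

context micro_transitive_space
begin

text \<open>The real parts support the same point and hence agree; rotating the argument recovers
  the scalar functionals from their real parts.\<close>

lemma state_unique:
  assumes "(x, f) \<in> states sc" "(x, f') \<in> states sc"
  shows "f = f'"
proof
  fix z
  note f = stateD[OF assms(1)] and f' = stateD[OF assms(2)]
  have *: "(\<lambda>z. re (f z)) = (\<lambda>z. re (f' z))"
    using support_unique[OF f(1) state_dual_ball[OF assms(1)] _ state_dual_ball[OF assms(2)]]
      f(4) f'(4) re_one by simp
  obtain u where "norm u = 1" and u: "re (u * (f z - f' z)) = norm (f z - f' z)"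
    using re_rotate by blast
  have "re (u * (f z - f' z)) = re (f (sc u z) - f' (sc u z))"
    by (simp add: KfunctionalD[OF f(2)] KfunctionalD[OF f'(2)] algebra_simps)
  also have "\<dots> = 0"
    using fun_cong[OF *, of "sc u z"] re_linear by (simp add: linear_diff)
  finally show "f z = f' z"
    using u by simp
qed

section \<open>Numerical radius and its perturbation\<close>

lemma nradius_eq: "nradius sc T = (SUP (x, f) \<in> states sc. norm (f (T x)))"
  using base_state by (auto simp: nradius_def)

lemma nradius_ge:
  assumes "bounded_linear T" "(x, f) \<in> states sc"
  shows "norm (f (T x)) \<le> nradius sc T"
proof -
  have "bdd_above ((\<lambda>(x, f). norm (f (T x))) ` states sc)"
  proof (rule bdd_aboveI2)
    fix p assume p: "p \<in> states sc"
    obtain y k where [simp]: "p = (y, k)" by fastforce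
    have "norm (k (T y)) \<le> norm (T y)" "norm y = 1"
      using stateD p by auto
    then show "(case p of (x, f) \<Rightarrow> norm (f (T x))) \<le> onorm T"
      using onorm[OF assms(1), of y] by simp
  qed
  from cSUP_upper[OF assms(2) this] show ?thesis
    by (simp add: nradius_eq)
qed

lemma nradius_le:
  assumes "\<And>x f. (x, f) \<in> states sc \<Longrightarrow> norm (f (T x)) \<le> c"
  shows "nradius sc T \<le> c"
  unfolding nradius_eq using assms base_state by (intro cSUP_least) auto

lemma nradius_approx:
  assumes "\<eta> > 0"
  shows "\<exists>y k. (y, k) \<in> states sc \<and> nradius sc T - \<eta> < norm (k (T y))"
proof (rule ccontr)
  assume "\<not> ?thesis"
  then have "nradius sc T \<le> nradius sc T - \<eta>"
    by (intro nradius_le) (auto simp: not_less)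
  then show False using assms by simp
qed

lemma nradius_perturb:
  assumes "bounded_linear S" "\<And>z. norm (T z - S z) \<le> c * norm z"
  shows "nradius sc T \<le> nradius sc S + c"
proof (rule nradius_le)
  fix x f assume xf: "(x, f) \<in> states sc"
  note f = stateD[OF xf]
  have "norm (f (T x)) \<le> norm (f (S x)) + norm (f (T x - S x))"
    using norm_triangle_ineq[of "f (S x)" "f (T x - S x)"] by (simp add: KfunctionalD[OF f(2)])
  also have "\<dots> \<le> nradius sc S + c"
    using nradius_ge[OF assms(1) xf] f(3)[of "T x - S x"] assms(2)[of x] f(1) by (simp add: add_mono)
  finally show "norm (f (T x)) \<le> nradius sc S + c" .
qed

text \<open>Adding a rank-one operator that increases the value at \<^term>\<open>x\<close> forces almost maximal states
  to be near \<^term>\<open>x\<close> up to a rotation; an isometry close to the identity moves such a state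
  back to \<^term>\<open>x\<close>.\<close>

lemma improve:
  assumes "\<epsilon> > 0" "M > 0"
  shows "\<exists>\<eta>>0. \<forall>T x f \<eta>'. Klinear sc T \<and> (\<forall>z. norm (T z) \<le> M * norm z) \<and> (x, f) \<in> states sc \<and>
      nradius sc T - \<eta> < norm (f (T x)) \<and> \<eta>' > 0 \<longrightarrow>
    (\<exists>S. Klinear sc S \<and> (\<forall>z. norm (S z - T z) \<le> \<epsilon> * norm z) \<and> nradius sc S - \<eta>' < norm (f (S x)))"
proof -
  \<comment> \<open>Half of \<epsilon> pays for the rank-one term. Conjugation displaces twice, each
    time by at most \<open>\<delta> * M'\<close>, a quarter of \<epsilon>.\<close>
  define \<alpha> where "\<alpha> = \<epsilon> / 2"
  define M' where "M' = M + \<alpha>"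
  define \<delta> where "\<delta> = \<epsilon> / (4 * M')"
  have pos: "\<alpha> > 0" "M' > 0" "\<delta> > 0"
    using assms by (auto simp: \<alpha>_def M'_def \<delta>_def)
  obtain \<rho> where "\<rho> > 0" and \<rho>: "\<And>x y. norm x = 1 \<Longrightarrow> norm y = 1 \<Longrightarrow> norm (y - x) < \<rho> \<Longrightarrow>
      (\<exists>g\<in>isometry_group sc. (\<forall>z. norm (g z - z) \<le> \<delta> * norm z) \<and> g x = y)"
    using uniformly_micro_transitive[OF pos(3)] by blast
  obtain \<gamma> where "\<gamma> > 0" and \<gamma>: "\<And>(x::'b) \<phi> y. norm x = 1 \<Longrightarrow> dual_ball \<phi> \<Longrightarrow> \<phi> x = 1 \<Longrightarrow> norm y \<le> 1 \<Longrightarrow>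
      1 - \<gamma> \<le> \<phi> y \<Longrightarrow> norm (x - y) < \<rho>"
    using uniformly_convex[OF \<open>\<rho> > 0\<close>] by blast
  \<comment> \<open>Chosen so that the total loss \<open>2 * \<eta>\<close> is
    \<open>\<alpha> * \<gamma>\<close>, the slack in
    \<open>1 - \<gamma> \<le> norm (f y)\<close>.\<close>
  define \<eta> where "\<eta> = \<alpha> * \<gamma> / 2"
  have "\<eta> > 0"
    using pos \<open>\<gamma> > 0\<close> by (simp add: \<eta>_def)
  have "\<exists>S. Klinear sc S \<and> (\<forall>z. norm (S z - T z) \<le> \<epsilon> * norm z) \<and> nradius sc S - \<eta>' < norm (f (S x))"
    if T: "Klinear sc T" "\<And>z. norm (T z) \<le> M * norm z" and xf: "(x, f) \<in> states sc"
      and near: "nradius sc T - \<eta> < norm (f (T x))" and "\<eta>' > 0" for T x f \<eta>'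
  proof -
    note f = stateD[OF xf] and blT = KlinearD(1)[OF T(1)]
    define a where "a = f (T x)"
    \<comment> \<open>The phase of \<open>a\<close>, so that the added term lengthens
      \<open>a\<close> by exactly \<alpha>; for \<open>a = 0\<close> any phase serves.\<close>
    define u where "u = (if a = 0 then 1 else a / of_real (norm a))"
    have u: "norm u = 1" and au: "norm (a + of_real \<alpha> * u) = norm a + \<alpha>"
    proof -
      show "norm u = 1"
        by (simp add: u_def norm_divide)
      have "a = of_real (norm a) * u"
        by (simp add: u_def)
      then have "a + of_real \<alpha> * u = of_real (norm a + \<alpha>) * u"
        by (metis distrib_right of_real_add)
      then show "norm (a + of_real \<alpha> * u) = norm a + \<alpha>"
        using \<open>norm u = 1\<close> pos by (simp add: norm_mult del: of_real_add)
    qed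
    define T' where "T' = (\<lambda>z. T z + sc (of_real \<alpha> * u * f z) x)"
    have KT': "Klinear sc T'"
      unfolding T'_def by (intro Klinear_add T(1) Klinear_rank_one f(2))
    note blT' = KlinearD(1)[OF KT']
    have rank: "norm (sc (of_real \<alpha> * u * f z) w) \<le> \<alpha> * norm z * norm w" for z w
      using f(3)[of z] u pos by (simp add: norm_sc norm_mult mult_right_mono mult_left_mono)
    have T'T: "norm (T' z - T z) \<le> \<alpha> * norm z" for z
      using rank[of z x] f(1) by (simp add: T'_def)
    have T'M: "norm (T' z) \<le> M' * norm z" for z
      using T(2)[of z] T'T[of z] norm_triangle_ineq[of "T z" "T' z - T z"]
      by (simp add: M'_def algebra_simps)
    have fT': "f (T' z) = f (T z) + of_real \<alpha> * u * f z" for z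
      by (simp add: T'_def KfunctionalD[OF f(2)] f(4))
    have "nradius sc T + \<alpha> - \<eta> < norm a + \<alpha>"
      using near by (simp add: a_def)
    also have "\<dots> = norm (f (T' x))"
      by (simp add: fT' f(4) a_def[symmetric] au)
    also have "\<dots> \<le> nradius sc T'"
      by (rule nradius_ge[OF blT' xf])
    finally have big: "nradius sc T + \<alpha> - \<eta> < nradius sc T'" .
    \<comment> \<open>Here \<eta> forces \<open>norm (f y)\<close> to be almost 1, and
      \<open>\<eta>'\<close> becomes the accuracy of the new operator.\<close>
    obtain y k where yk: "(y, k) \<in> states sc" and y: "nradius sc T' - min \<eta> \<eta>' < norm (k (T' y))"
      using nradius_approx[of "min \<eta> \<eta>'" T'] \<open>\<eta> > 0\<close> \<open>\<eta>' > 0\<close> by auto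
    note k = stateD[OF yk]
    have "norm (k (T' y)) \<le> norm (k (T y)) + \<alpha> * norm (f y)"
    proof -
      have "k (T' y) = k (T y) + of_real \<alpha> * u * f y * k x"
        by (simp add: T'_def KfunctionalD[OF k(2)])
      then have "norm (k (T' y)) \<le> norm (k (T y)) + \<alpha> * norm (f y) * norm (k x)"
        using norm_triangle_ineq[of "k (T y)" "of_real \<alpha> * u * f y * k x"] u pos
        by (simp add: norm_mult)
      also have "\<dots> \<le> norm (k (T y)) + \<alpha> * norm (f y)"
        using k(3)[of x] f(1) pos by (simp add: mult_left_le)
      finally show ?thesis .
    qed
    also have "norm (k (T y)) \<le> nradius sc T"
      by (rule nradius_ge[OF blT yk])
    finally have "\<alpha> - 2 * \<eta> \<le> \<alpha> * norm (f y)"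
      using big y by simp
    then have "\<alpha> * (1 - \<gamma>) \<le> \<alpha> * norm (f y)"
      by (simp add: \<eta>_def algebra_simps)
    then have fy: "1 - \<gamma> \<le> norm (f y)"
      using pos by (simp only: mult_le_cancel_left_pos)
    \<comment> \<open>Rotating \<open>y\<close> by \<open>w\<close> places it in the thin slice of
      \<open>f\<close> at \<open>x\<close>, where uniform convexity applies.\<close>
    obtain w where w: "norm w = 1" "re (w * f y) = norm (f y)"
      using re_rotate by blast
    define y' k' where "y' = sc w y" and "k' = (\<lambda>z. k (sc (inverse w) z))"
    have y'k': "(y', k') \<in> states sc"
      unfolding y'_def k'_def by (rule state_rotate[OF yk w(1)])
    have "w \<noteq> 0"
      using w(1) by auto
    then have k'y': "k' (T' y') = k (T' y)"
      by (simp add: k'_def y'_def KlinearD[OF KT'] sc_mult)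
    have "norm (x - y') < \<rho>"
      using \<gamma>[OF f(1) state_dual_ball[OF xf], of y'] f(4) re_one stateD(1)[OF y'k'] fy w(2)
      by (simp add: y'_def KfunctionalD[OF f(2)])
    then obtain g where g: "g \<in> isometry_group sc" "\<And>z. norm (g z - z) \<le> \<delta> * norm z" "g x = y'"
      using \<rho>[of x y'] f(1) stateD(1)[OF y'k'] by (auto simp: norm_minus_commute)
    obtain h where h: "h \<in> isometry_group sc" "\<And>x. g (h x) = x" "\<And>x. h (g x) = x"
      using isometry_group_inverse[OF g(1)] by blast
    note Kg = isometry_groupD(1)[OF g(1)] and Kh = isometry_groupD(1)[OF h(1)]
    \<comment> \<open>Uniqueness of the state at \<open>x\<close> ensures that the transported
      functional is the given \<open>f\<close>.\<close>
    have f_eq: "f = (\<lambda>z. k' (g z))"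
      using state_isometry[OF y'k' g(1,3)] by (rule state_unique[OF xf])
    define S where "S = (\<lambda>z. h (T' (g z)))"
    have KS: "Klinear sc S"
      unfolding S_def by (rule Klinear_comp[OF Kh Klinear_comp[OF KT' Kg]])
    have "nradius sc S \<le> nradius sc T'"
    proof (rule nradius_le)
      fix v l assume vl: "(v, l) \<in> states sc"
      have "(g v, \<lambda>z. l (h z)) \<in> states sc"
        by (rule state_isometry[OF vl h(1)]) (rule h(3))
      from nradius_ge[OF blT' this] show "norm (l (S v)) \<le> nradius sc T'"
        by (simp add: S_def)
    qed
    moreover have "f (S x) = k (T' y)"
      unfolding f_eq by (simp add: S_def h(2) g(3) k'y')
    ultimately have "nradius sc S - \<eta>' < norm (f (S x))"
      using y by simp
    moreover have "norm (S z - T z) \<le> \<epsilon> * norm z" for z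
    proof -
      have "norm (S z - T' (g z)) \<le> \<delta> * norm (T' (g z))"
        unfolding S_def using inverse_displacement[OF g(1,2) h(2,1)] .
      also have "\<dots> \<le> \<delta> * (M' * norm z)"
        using T'M[of "g z"] isometry_groupD(3)[OF g(1), of z] pos by (intro mult_left_mono) auto
      finally have 1: "norm (S z - T' (g z)) \<le> \<delta> * M' * norm z"
        by simp
      have "norm (T' (g z) - T' z) = norm (T' (g z - z))"
        by (simp add: KlinearD[OF KT'])
      also have "\<dots> \<le> M' * norm (g z - z)"
        by (rule T'M)
      also have "\<dots> \<le> M' * (\<delta> * norm z)"
        using g(2)[of z] pos by (intro mult_left_mono) auto
      finally have 2: "norm (T' (g z) - T' z) \<le> \<delta> * M' * norm z"
        by (simp add: mult_ac)
      have "norm (A + B + C) \<le> norm A + norm B + norm C" for A B C :: 'b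
        using norm_triangle_ineq[of "A + B" C] norm_triangle_ineq[of A B] by linarith
      from this[of "S z - T' (g z)" "T' (g z) - T' z" "T' z - T z"]
      have "norm (S z - T z) \<le> norm (S z - T' (g z)) + norm (T' (g z) - T' z) + norm (T' z - T z)"
        by simp
      also have "\<dots> \<le> (2 * (\<delta> * M') + \<alpha>) * norm z"
        using 1 2 T'T[of z] by (simp add: algebra_simps)
      also have "2 * (\<delta> * M') + \<alpha> = \<epsilon>"
        using pos by (simp add: \<delta>_def \<alpha>_def)
      finally show ?thesis .
    qed
    ultimately show ?thesis
      using KS by blast
  qed
  then show ?thesis
    using \<open>\<eta> > 0\<close> by (intro exI[of _ \<eta>]) simp
qed

text \<open>Iterating \<open>improve\<close> with summable steps, each reaching the accuracy that
  the next one requires, gives a convergent sequence of operators whose defect at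
  \<open>(x, f)\<close> tends to 0.\<close>

lemma attain:
  assumes "\<epsilon> > 0" "M > 0"
  shows "\<exists>\<eta>>0. \<forall>T x f. Klinear sc T \<and> (\<forall>z. norm (T z) \<le> M * norm z) \<and> (x, f) \<in> states sc \<and>
      nradius sc T - \<eta> < norm (f (T x)) \<longrightarrow>
    (\<exists>S. Klinear sc S \<and> (\<forall>z. norm (S z - T z) \<le> \<epsilon> * norm z) \<and> norm (f (S x)) = nradius sc S)"
proof -
  define e where "e n = \<epsilon> / 2 ^ (n + 2)" for n :: nat
  \<comment> \<open>The sum of the steps \<open>e k\<close> over all
    \<open>k \<ge> n\<close>.\<close>
  define b where "b n = \<epsilon> / 2 ^ (n + 1)" for n :: nat
  have e: "e n > 0" for n
    using assms by (simp add: e_def)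
  have b: "b n > 0" "b n - e n = b (Suc n)" "b n = 2 * e n" for n
    using assms by (simp_all add: b_def e_def field_simps)
  have b_lim: "b \<longlonglongrightarrow> 0"
    unfolding b_def using LIMSEQ_ignore_initial_segment[OF LIMSEQ_divide_realpow_zero[of 2 \<epsilon>], of 1]
    by simp
  \<comment> \<open>The bound \<open>M + \<epsilon>\<close> holds for all iterates, so the
    thresholds can be fixed before \<open>T\<close> is known.\<close>
  define R where "R n \<eta> \<longleftrightarrow> \<eta> > 0 \<and> (\<forall>T x f \<eta>'. Klinear sc T \<and> (\<forall>z. norm (T z) \<le> (M + \<epsilon>) * norm z) \<and>
      (x, f) \<in> states sc \<and> nradius sc T - \<eta> < norm (f (T x)) \<and> \<eta>' > 0 \<longrightarrow>
    (\<exists>S. Klinear sc S \<and> (\<forall>z. norm (S z - T z) \<le> e n * norm z) \<and> nradius sc S - \<eta>' < norm (f (S x))))"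
    for n \<eta>
  have "\<exists>\<eta>. R n \<eta>" for n
    unfolding R_def using improve[OF e, of "M + \<epsilon>" n] assms by simp
  then obtain h where R: "\<And>n. R n (h n)"
    by metis
  have h: "h n > 0" for n
    using R[of n] by (simp add: R_def)
  have next_op: "\<exists>S. Klinear sc S \<and> (\<forall>z. norm (S z - T z) \<le> e n * norm z) \<and> nradius sc S - \<eta>' < norm (f (S x))"
    if "Klinear sc T" "\<And>z. norm (T z) \<le> (M + \<epsilon>) * norm z" "(x, f) \<in> states sc"
      "nradius sc T - h n < norm (f (T x))" "\<eta>' > 0" for n T x f \<eta>'
    using R[of n] that by (simp add: R_def)
  have "\<exists>S. Klinear sc S \<and> (\<forall>z. norm (S z - T z) \<le> \<epsilon> * norm z) \<and> norm (f (S x)) = nradius sc S"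
    if T: "Klinear sc T" "\<And>z. norm (T z) \<le> M * norm z" and xf: "(x, f) \<in> states sc"
      and near: "nradius sc T - min (h 0) (e 0) < norm (f (T x))" for T x f
  proof -
    note f = stateD[OF xf]
    \<comment> \<open>\<open>h n\<close> permits the next improvement; \<open>e n\<close> drives the
      defect to 0.\<close>
    define P where "P n S \<longleftrightarrow> Klinear sc S \<and> (\<forall>z. norm (S z - T z) \<le> (\<epsilon> / 2 - b n) * norm z) \<and>
      nradius sc S - min (h n) (e n) < norm (f (S x))" for n S
    define Q where "Q n S S' \<longleftrightarrow> (\<forall>z. norm (S' z - S z) \<le> e n * norm z)" for n :: nat and S S' :: "'b \<Rightarrow> 'b"
    have "\<exists>X. \<forall>n. P n (X n) \<and> Q n (X n) (X (Suc n))"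
    proof (rule dependent_nat_choice)
      show "\<exists>S. P 0 S"
        unfolding P_def using T(1) near by (intro exI[of _ T]) (simp add: b_def)
    next
      fix S n assume S: "P n S"
      then have KS: "Klinear sc S" and ST: "\<And>z. norm (S z - T z) \<le> (\<epsilon> / 2 - b n) * norm z"
        and Sx: "nradius sc S - h n < norm (f (S x))"
        by (auto simp: P_def)
      have "norm (S z) \<le> (M + \<epsilon>) * norm z" for z
      proof -
        have "norm (S z) \<le> norm (T z) + norm (S z - T z)"
          using norm_triangle_ineq[of "T z" "S z - T z"] by simp
        also have "\<dots> \<le> (M + (\<epsilon> / 2 - b n)) * norm z"
          using T(2)[of z] ST[of z] by (simp add: distrib_right)
        also have "\<dots> \<le> (M + \<epsilon>) * norm z"
          using b(1)[of n] assms by (intro mult_right_mono) auto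
        finally show ?thesis .
      qed
      from next_op[OF KS this xf Sx, of "min (h (Suc n)) (e (Suc n))"]
      obtain S' where S': "Klinear sc S'" "\<And>z. norm (S' z - S z) \<le> e n * norm z"
        "nradius sc S' - min (h (Suc n)) (e (Suc n)) < norm (f (S' x))"
        using h e by auto
      have "norm (S' z - T z) \<le> (\<epsilon> / 2 - b (Suc n)) * norm z" for z
      proof -
        have "norm (S' z - T z) \<le> norm (S' z - S z) + norm (S z - T z)"
          using norm_triangle_ineq[of "S' z - S z" "S z - T z"] by simp
        also have "\<dots> \<le> (e n + (\<epsilon> / 2 - b n)) * norm z"
          using S'(2)[of z] ST[of z] by (simp add: distrib_right)
        also have "e n + (\<epsilon> / 2 - b n) = \<epsilon> / 2 - b (Suc n)"
          using b(2)[of n] by simp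
        finally show ?thesis .
      qed
      then show "\<exists>S'. P (Suc n) S' \<and> Q n S S'"
        unfolding P_def Q_def using S' by (intro exI[of _ S']) simp
    qed
    then obtain X where X: "\<And>n. P n (X n)" "\<And>n. Q n (X n) (X (Suc n))"
      by blast
    have KX: "Klinear sc (X n)" and XT: "norm (X n z - T z) \<le> (\<epsilon> / 2 - b n) * norm z"
      and Xx: "nradius sc (X n) - e n < norm (f (X n x))" for n z
      using X(1)[of n] by (auto simp: P_def)
    have tail: "norm (X (n + k) z - X n z) \<le> (b n - b (n + k)) * norm z" for n k z
    proof (induction k)
      case (Suc k)
      have "norm (X (n + Suc k) z - X n z) \<le> norm (X (Suc (n + k)) z - X (n + k) z) + norm (X (n + k) z - X n z)"
        using norm_triangle_ineq[of "X (Suc (n + k)) z - X (n + k) z" "X (n + k) z - X n z"] by simp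
      also have "\<dots> \<le> e (n + k) * norm z + (b n - b (n + k)) * norm z"
        using Suc X(2)[of "n + k"] by (intro add_mono) (simp_all add: Q_def)
      also have "\<dots> = (b n - b (n + Suc k)) * norm z"
        using b(2)[of "n + k"] by (simp add: distrib_right[symmetric])
      finally show ?case .
    qed simp
    have tail': "norm (X (n + k) z - X n z) \<le> b n * norm z" for n k z
      by (rule order_trans[OF tail], rule mult_right_mono) (use b(1)[of "n + k"] in auto)
    have "convergent (\<lambda>n. X n z)" for z
    proof (rule Cauchy_convergent, unfold Cauchy_altdef2, intro allI impI)
      fix r :: real assume "r > 0"
      have "(\<lambda>n. b n * norm z) \<longlonglongrightarrow> 0 * norm z"
        by (intro tendsto_intros b_lim)
      then obtain N where N: "b N * norm z < r"
        using \<open>r > 0\<close> by (auto dest!: order_tendstoD(2)[where a = r] eventually_happens)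
      have "dist (X n z) (X N z) < r" if "n \<ge> N" for n
        using tail'[of N "n - N" z] that N by (simp add: dist_norm)
      then show "\<exists>N. \<forall>n\<ge>N. dist (X n z) (X N z) < r"
        by blast
    qed
    then obtain S where S: "\<And>z. (\<lambda>n. X n z) \<longlonglongrightarrow> S z"
      unfolding convergent_def by metis
    have SX: "norm (S z - X n z) \<le> b n * norm z" for z n
    proof (rule LIMSEQ_le_const2)
      show "(\<lambda>k. norm (X (k + n) z - X n z)) \<longlonglongrightarrow> norm (S z - X n z)"
        by (intro tendsto_intros LIMSEQ_ignore_initial_segment S)
      show "\<exists>N. \<forall>k\<ge>N. norm (X (k + n) z - X n z) \<le> b n * norm z"
        using tail'[of n _ z] by (simp add: add.commute)
    qed
    have ST: "norm (S z - T z) \<le> \<epsilon> * norm z" for z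
    proof -
      have "norm (S z - T z) \<le> norm (S z - X 0 z) + norm (X 0 z - T z)"
        using norm_triangle_ineq[of "S z - X 0 z" "X 0 z - T z"] by simp
      also have "\<dots> \<le> b 0 * norm z + (\<epsilon> / 2 - b 0) * norm z"
        using SX[of z 0] XT[of 0 z] by simp
      also have "\<dots> = \<epsilon> / 2 * norm z"
        by (simp add: algebra_simps)
      also have "\<dots> \<le> \<epsilon> * norm z"
        using assms by (intro mult_right_mono) auto
      finally show ?thesis .
    qed
    have KS: "Klinear sc S"
      unfolding Klinear_def
    proof (intro conjI allI bounded_linear_intro)
      show "S (y + z) = S y + S z" for y z
        using tendsto_add[OF S[of y] S[of z]] LIMSEQ_unique[OF S[of "y + z"]] by (simp add: KlinearD[OF KX])
      show "S (r *\<^sub>R z) = r *\<^sub>R S z" for r z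
        using tendsto_scaleR[OF tendsto_const S[of z], of r] LIMSEQ_unique[OF S[of "r *\<^sub>R z"]]
        by (simp add: KlinearD[OF KX])
      show "S (sc c z) = sc c (S z)" for c z
        using bounded_linear.tendsto[OF bounded_linear_sc S[of z], of c] LIMSEQ_unique[OF S[of "sc c z"]]
        by (simp add: KlinearD[OF KX])
      show "norm (S z) \<le> norm z * (M + \<epsilon>)" for z
        using norm_triangle_ineq[of "T z" "S z - T z"] T(2)[of z] ST[of z] by (simp add: algebra_simps)
    qed
    \<comment> \<open>One \<open>b n\<close> for the numerical radius, one for the value at the
      state, and one for the defect \<open>e n\<close>.\<close>
    have "nradius sc S \<le> norm (f (S x)) + 3 * b n" for n
    proof -
      have "nradius sc S \<le> nradius sc (X n) + b n"
        by (rule nradius_perturb[OF KlinearD(1)[OF KX] SX])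
      moreover have "norm (f (X n x)) \<le> norm (f (S x)) + b n"
      proof -
        have "norm (f (X n x)) \<le> norm (f (S x)) + norm (f (S x - X n x))"
          using norm_triangle_ineq4[of "f (S x)" "f (S x - X n x)"] by (simp add: KfunctionalD[OF f(2)])
        then show ?thesis
          using f(3)[of "S x - X n x"] SX[of x n] f(1) by simp
      qed
      moreover have "e n \<le> b n"
        using b(3)[of n] e[of n] by simp
      ultimately show ?thesis
        using Xx[of n] by simp
    qed
    moreover have "(\<lambda>n. norm (f (S x)) + 3 * b n) \<longlonglongrightarrow> norm (f (S x)) + 3 * 0"
      by (intro tendsto_intros b_lim)
    ultimately have "nradius sc S \<le> norm (f (S x))"
      using LIMSEQ_le_const[of "\<lambda>n. norm (f (S x)) + 3 * b n" "norm (f (S x))" "nradius sc S"] by auto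
    then show ?thesis
      using nradius_ge[OF KlinearD(1)[OF KS] xf] KS ST by (intro exI[of _ S]) auto
  qed
  moreover have "min (h 0) (e 0) > 0"
    using h e by simp
  ultimately show ?thesis
    by (intro exI[of _ "min (h 0) (e 0)"]) simp
qed

section \<open>The second numerical index and the point property\<close>

lemma Zset_state:
  assumes "G \<in> Zset sc" "(x, f) \<in> states sc"
  shows "f (G x) = 0"
  using nradius_ge[OF KlinearD(1) assms(2), of G] assms(1) by (simp add: Zset_def)

text \<open>For \<open>c\<close> strictly between 0 and the index, an operator of numerical radius 1
  has quotient norm below \<open>1 / c\<close>, so some representative attains this bound.\<close>

lemma second_nindex_pos:
  assumes "second_nindex sc > 0"
  shows "\<exists>C>0. \<forall>T. Klinear sc T \<and> nradius sc T = 1 \<longrightarrow> (\<exists>G\<in>Zset sc. onorm (\<lambda>z. T z - G z) \<le> C)"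
proof -
  obtain c where c: "0 < ereal c" "ereal c < second_nindex sc"
    using ereal_dense2[OF assms] by blast
  then have "c > 0" by simp
  have zero: "(\<lambda>_. 0) \<in> Zset sc"
  proof -
    have K: "Klinear sc (\<lambda>_. 0)"
      using sc_minus[of _ 0] by (simp add: Klinear_def norm_sc flip: norm_eq_zero)
    moreover have "nradius sc (\<lambda>_. 0) \<le> 0"
      using KfunctionalD(6)[OF stateD(2), of _ _ 0] by (intro nradius_le) fastforce
    moreover have "0 \<le> nradius sc (\<lambda>_. 0)"
      using nradius_ge[OF KlinearD(1)[OF K] base_state] norm_ge_zero order_trans by blast
    ultimately show ?thesis
      by (simp add: Zset_def)
  qed
  have "\<exists>G\<in>Zset sc. onorm (\<lambda>z. T z - G z) \<le> 1 / c" if T: "Klinear sc T" "nradius sc T = 1" for T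
  proof -
    have "T \<in> {T. Klinear sc T} - Zset sc"
      using T by (simp add: Zset_def)
    then have "second_nindex sc \<le> ereal (nradius sc T / qnorm sc T)"
      unfolding second_nindex_def by (rule INF_lower)
    then have "c < 1 / qnorm sc T"
      using c(2) T(2) by (simp add: less_le_trans flip: ereal_less_eq(3) less_ereal.simps(1))
    then have "qnorm sc T < 1 / c"
    proof (cases "qnorm sc T > 0")
      case True
      then show ?thesis
        using \<open>c < 1 / qnorm sc T\<close> \<open>c > 0\<close> by (simp add: field_simps)
    next
      case False
      moreover have "0 < 1 / c"
        using \<open>c > 0\<close> by simp
      ultimately show ?thesis by linarith
    qed
    then obtain G where "G \<in> Zset sc" "onorm (\<lambda>z. T z - G z) < 1 / c"
      unfolding qnorm_def using cInf_lessD[of "(\<lambda>G. onorm (\<lambda>z. T z - G z)) ` Zset sc" "1 / c"] zero by auto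
    then show ?thesis
      by (intro bexI[of _ G]) auto
  qed
  then show ?thesis
    using \<open>c > 0\<close> by (intro exI[of _ "1 / c"]) simp
qed

text \<open>Subtracting an element of \<^term>\<open>Zset sc\<close> does not affect any state, and the second numerical
  index makes the remainder bounded by a constant.\<close>

lemma BPBpp_nu:
  assumes "second_nindex sc > 0"
  shows "BPBpp_nu sc"
  unfolding BPBpp_nu_def
proof (intro allI impI)
  fix \<epsilon> :: real assume "\<epsilon> > 0"
  obtain C where "C > 0" and C: "\<And>T. Klinear sc T \<Longrightarrow> nradius sc T = 1 \<Longrightarrow>
      \<exists>G\<in>Zset sc. onorm (\<lambda>z. T z - G z) \<le> C"
    using second_nindex_pos[OF assms] by blast
  \<comment> \<open>\<open>4 * (C + 1)\<close> bounds the cost of rescaling \<open>S\<close>, and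
    the 1 is its distance from \<open>T'\<close>, both in units of \<open>e\<close>.\<close>
  define D where "D = 4 * (C + 1) + 1"
  define e where "e = min (1 / 4) (\<epsilon> / (2 * D))"
  have "D > 0"
    using \<open>C > 0\<close> by (simp add: D_def)
  then have e: "e > 0" "e \<le> 1 / 4" "D * e \<le> \<epsilon> / 2"
    using \<open>\<epsilon> > 0\<close> by (simp_all add: e_def min_def field_simps)
  obtain \<eta>\<^sub>0 where "\<eta>\<^sub>0 > 0" and \<eta>\<^sub>0: "\<And>T x f. Klinear sc T \<Longrightarrow> (\<forall>z. norm (T z) \<le> C * norm z) \<Longrightarrow>
      (x, f) \<in> states sc \<Longrightarrow> nradius sc T - \<eta>\<^sub>0 < norm (f (T x)) \<Longrightarrow>
      \<exists>S. Klinear sc S \<and> (\<forall>z. norm (S z - T z) \<le> e * norm z) \<and> norm (f (S x)) = nradius sc S"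
    using attain[OF e(1) \<open>C > 0\<close>] by metis
  define \<eta> where "\<eta> = min \<eta>\<^sub>0 e"
  have "\<exists>S. Klinear sc S \<and> nradius sc S = 1 \<and> norm (f (S x)) = 1 \<and> onorm (\<lambda>y. S y - T y) < \<epsilon>"
    if T: "Klinear sc T" "nradius sc T = 1" and xf: "(x, f) \<in> states sc" and near: "1 - \<eta> < norm (f (T x))"
    for T x f
  proof -
    obtain G where G: "G \<in> Zset sc" "onorm (\<lambda>z. T z - G z) \<le> C"
      using C[OF T] by blast
    have KG: "Klinear sc G"
      using G(1) by (simp add: Zset_def)
    define T' where "T' = (\<lambda>z. T z - G z)"
    have KT': "Klinear sc T'"
      unfolding T'_def by (rule Klinear_diff[OF T(1) KG])
    have T'C: "norm (T' z) \<le> C * norm z" for z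
      by (rule order_trans[OF onorm[OF KlinearD(1)[OF KT']]
            mult_right_mono[OF G(2)[folded T'_def] norm_ge_zero]])
    have state: "k (T' y) = k (T y)" if "(y, k) \<in> states sc" for y k
      using Zset_state[OF G(1) that] by (simp add: T'_def KfunctionalD[OF stateD(2)[OF that]])
    have v: "nradius sc T' = 1"
    proof (rule antisym)
      show "nradius sc T' \<le> 1"
      proof (rule nradius_le)
        show "norm (k (T' y)) \<le> 1" if "(y, k) \<in> states sc" for y k
          using nradius_ge[OF KlinearD(1)[OF T(1)] that] T(2) state[OF that] by simp
      qed
      have "nradius sc T \<le> nradius sc T'"
      proof (rule nradius_le)
        show "norm (k (T y)) \<le> nradius sc T'" if "(y, k) \<in> states sc" for y k
          using nradius_ge[OF KlinearD(1)[OF KT'] that] state[OF that] by simp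
      qed
      then show "1 \<le> nradius sc T'"
        using T(2) by simp
    qed
    have "nradius sc T' - \<eta>\<^sub>0 < norm (f (T' x))"
      using near v state[OF xf] by (simp add: \<eta>_def)
    then obtain S where S: "Klinear sc S" "\<And>z. norm (S z - T' z) \<le> e * norm z" "norm (f (S x)) = nradius sc S"
      using \<eta>\<^sub>0[OF KT' _ xf] T'C by blast
    define s where "s = nradius sc S"
    have "s \<le> 1 + e"
      using nradius_perturb[OF KlinearD(1)[OF KT'] S(2)] v by (simp add: s_def)
    moreover have "1 - e \<le> s"
    proof -
      have "norm (T' z - S z) \<le> e * norm z" for z
        using S(2)[of z] by (simp add: norm_minus_commute)
      from nradius_perturb[OF KlinearD(1)[OF S(1)] this] show ?thesis
        using v by (simp add: s_def)
    qed
    ultimately have s: "\<bar>1 - s\<bar> \<le> e" "1 / 2 \<le> s"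
      using e by auto
    \<comment> \<open>Rescaling restores numerical radius 1; adding \<open>G\<close> back returns
      near \<open>T\<close> without changing the value at any state.\<close>
    define S' where "S' = (\<lambda>z. (1 / s) *\<^sub>R S z + G z)"
    have KS': "Klinear sc S'"
      unfolding S'_def by (rule Klinear_add[OF Klinear_scaleR[OF S(1)] KG])
    have S'_state: "norm (k (S' y)) = norm (k (S y)) / s" if "(y, k) \<in> states sc" for y k
      using Zset_state[OF G(1) that] s(2) by (simp add: S'_def KfunctionalD[OF stateD(2)[OF that]])
    have S'x: "norm (f (S' x)) = 1"
      using S'_state[OF xf] S(3) s(2) by (simp add: s_def)
    have "nradius sc S' = 1"
    proof (rule antisym)
      show "nradius sc S' \<le> 1"
      proof (rule nradius_le)
        show "norm (k (S' y)) \<le> 1" if "(y, k) \<in> states sc" for y k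
          using nradius_ge[OF KlinearD(1)[OF S(1)] that] S'_state[OF that] s(2)
          by (simp add: pos_divide_le_eq s_def)
      qed
      show "1 \<le> nradius sc S'"
        using nradius_ge[OF KlinearD(1)[OF KS'] xf] S'x by simp
    qed
    moreover have "onorm (\<lambda>z. S' z - T z) \<le> D * e"
    proof (rule onorm_bound)
      show "0 \<le> D * e"
        using e(1) \<open>D > 0\<close> by simp
      fix z
      have "norm (S z) \<le> (C + 1) * norm z"
        using norm_triangle_ineq[of "T' z" "S z - T' z"] T'C[of z] S(2)[of z]
          mult_right_mono[of e 1 "norm z"] e(2) by (simp add: distrib_right)
      moreover have "\<bar>1 / s - 1\<bar> \<le> 4 * e"
      proof -
        have "1 / s - 1 = (1 - s) / s"
          using s(2) by (simp add: diff_divide_distrib)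
        then have "\<bar>1 / s - 1\<bar> = \<bar>1 - s\<bar> / s"
          using s(2) by (simp add: abs_divide)
        also have "\<dots> \<le> e / (1 / 2)"
          using s e by (intro frac_le) auto
        finally show ?thesis using e by simp
      qed
      ultimately have "\<bar>1 / s - 1\<bar> * norm (S z) \<le> 4 * e * ((C + 1) * norm z)"
        using e by (intro mult_mono) auto
      moreover have "norm ((1 / s) *\<^sub>R S z - S z) = \<bar>1 / s - 1\<bar> * norm (S z)"
        by (metis norm_scaleR scaleR_diff_left scaleR_one)
      moreover have "S' z - T z = ((1 / s) *\<^sub>R S z - S z) + (S z - T' z)"
        by (simp add: S'_def T'_def)
      then have "norm (S' z - T z) \<le> norm ((1 / s) *\<^sub>R S z - S z) + norm (S z - T' z)"
        by (metis norm_triangle_ineq)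
      ultimately show "norm (S' z - T z) \<le> D * e * norm z"
        using S(2)[of z] by (simp add: D_def algebra_simps)
    qed
    ultimately show ?thesis
      using KS' S'x e(3) \<open>\<epsilon> > 0\<close> by (intro exI[of _ S']) auto
  qed
  moreover have "\<eta> > 0"
    using \<open>\<eta>\<^sub>0 > 0\<close> e(1) by (simp add: \<eta>_def)
  ultimately show "\<exists>\<eta>>0. \<forall>T x f. Klinear sc T \<and> nradius sc T = 1 \<and> (x, f) \<in> states sc \<and> 1 - \<eta> < norm (f (T x)) \<longrightarrow>
      (\<exists>S. Klinear sc S \<and> nradius sc S = 1 \<and> norm (f (S x)) = 1 \<and> onorm (\<lambda>y. S y - T y) < \<epsilon>)"
    by (intro exI[of _ \<eta>]) simp
qed

end

section \<open>The theorem for both scalar fields\<close>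

lemma (in scaled_space) BPBpp_nu_if_micro_transitive:
  assumes "micro_transitive sc" "second_nindex sc > 0"
  shows "BPBpp_nu sc"
proof (cases "states sc = {}")
  \<comment> \<open>Without states the property is vacuous, and any \<open>\<eta>\<close>
    serves.\<close>
  case True
  then show ?thesis
    by (auto simp: BPBpp_nu_def intro!: exI[of _ 1])
next
  case False
  then obtain x f where "(x, f) \<in> states sc"
    by auto
  then interpret micro_transitive_space sc re x f
    using assms(1) by unfold_locales
  show ?thesis
    by (rule BPBpp_nu[OF assms(2)])
qed

theorem theorem2p1:
  shows "(micro_transitive (scaleR :: real \<Rightarrow> 'a::banach \<Rightarrow> 'a) \<and> second_nindex (scaleR :: real \<Rightarrow> 'a \<Rightarrow> 'a) > 0
            \<longrightarrow> BPBpp_nu (scaleR :: real \<Rightarrow> 'a \<Rightarrow> 'a))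
       \<and> (\<forall>sc :: complex \<Rightarrow> 'b::banach \<Rightarrow> 'b.
            K_scaling sc \<and> micro_transitive sc \<and> second_nindex sc > 0 \<longrightarrow> BPBpp_nu sc)"
proof (intro conjI impI allI; elim conjE)
  assume *: "micro_transitive (scaleR :: real \<Rightarrow> 'a \<Rightarrow> 'a)" "second_nindex (scaleR :: real \<Rightarrow> 'a \<Rightarrow> 'a) > 0"
  interpret scaled_space "scaleR :: real \<Rightarrow> 'a \<Rightarrow> 'a" "\<lambda>r. r"
  proof (rule scaled_space.intro)
    show "K_scaling (scaleR :: real \<Rightarrow> 'a \<Rightarrow> 'a)"
      by (simp add: K_scaling_def scaleR_add_left scaleR_add_right)
    show "\<exists>u. norm u = 1 \<and> u * a = norm a" for a :: real
      by (rule exI[of _ "if a < 0 then -1 else 1"]) simp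
  qed (simp_all add: linear_ident)
  show "BPBpp_nu (scaleR :: real \<Rightarrow> 'a \<Rightarrow> 'a)"
    by (rule BPBpp_nu_if_micro_transitive[OF *])
next
  fix sc :: "complex \<Rightarrow> 'b \<Rightarrow> 'b"
  assume *: "K_scaling sc" "micro_transitive sc" "second_nindex sc > 0"
  interpret scaled_space sc Re
  proof (rule scaled_space.intro)
    show "linear Re"
      by (simp add: bounded_linear.linear bounded_linear_Re)
    show "\<exists>u. norm u = 1 \<and> Re (u * a) = norm a" for a :: complex
    proof (cases "a = 0")
      case False
      have "cnj (sgn a) * a = of_real (norm a)"
        using False by (simp add: sgn_div_norm complex_norm_square[symmetric] scaleR_conv_of_real
            mult.assoc mult.commute[of "cnj a"] power2_eq_square)
      then show ?thesis
        using False by (intro exI[of _ "cnj (sgn a)"]) (simp add: norm_sgn)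
    qed (auto intro: exI[of _ 1])
  qed (simp_all add: *(1) complex_Re_le_cmod)
  show "BPBpp_nu sc"
    by (rule BPBpp_nu_if_micro_transitive[OF *(2,3)])
qed

end
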